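(* There exists an integer $d_0>0$ such that for every fixed integer $d\geq d_0$, if $G$ is the uniformly random $d$-regular graph on $2n$ labeled vertices, then with probability tending to $1$ as $n\to\infty$, $$\frac{d}{2}-10\sqrt{d\ln d}-4\sqrt{d}< r_\ell(G,\mathcal{PM})\leq \frac{d}{2}+2\sqrt{d\ln d}+2.$$
   Context: For a monotone increasing graph property $\mathcal{P}$ and a graph $G$, the local resilience is $r_\ell(G,\mathcal{P})=\min\{r: \exists H\subseteq G \text{ with } \Delta(H)=r \text{ and } G- H\notin\mathcal{P}\}$, where $H\subseteq G$ is a subgraph on the same vertex set, $\Delta(H)$ its maximum degree, and $G-H$ the graph obtained by deleting the edges of $H$. $\mathcal{PM}$ denotes the property of containing a perfect matching. *)

theory Defs
  imports "HOL-Probability.Probability"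
begin

type_synonym 'a graph = "'a set \<times> 'a set set"

abbreviation verts :: "'a graph \<Rightarrow> 'a set" where "verts \<equiv> fst"
abbreviation edges :: "'a graph \<Rightarrow> 'a set set" where "edges \<equiv> snd"

definition simple_graph :: "'a graph \<Rightarrow> bool" where
  "simple_graph G \<longleftrightarrow> finite (verts G) \<and> (\<forall>e\<in>edges G. e \<subseteq> verts G \<and> card e = 2)"

definition vertex_degree :: "'a graph \<Rightarrow> 'a \<Rightarrow> nat" where
  "vertex_degree G v = card {e \<in> edges G. v \<in> e}"

definition max_degree :: "'a graph \<Rightarrow> nat" where
  "max_degree G = Max (vertex_degree G ` verts G)"

definition spanning_subgraph :: "'a graph \<Rightarrow> 'a graph \<Rightarrow> bool" where
  "spanning_subgraph H G \<longleftrightarrow> verts H = verts G \<and> edges H \<subseteq> edges G"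

definition delete_edges :: "'a graph \<Rightarrow> 'a graph \<Rightarrow> 'a graph" where
  "delete_edges G H = (verts G, edges G - edges H)"

definition monotone_increasing :: "('a graph \<Rightarrow> bool) \<Rightarrow> bool" where
  "monotone_increasing P \<longleftrightarrow>
     (\<forall>G H. simple_graph G \<longrightarrow> spanning_subgraph H G \<longrightarrow> P H \<longrightarrow> P G)"

text \<open>The minimum is attained as soon as some spanning subgraph of \<open>G\<close> fails to have \<open>P\<close>; if there
  is none, the value below is unspecified.\<close>

definition local_resilience :: "'a graph \<Rightarrow> ('a graph \<Rightarrow> bool) \<Rightarrow> nat" where
  "local_resilience G P =
     (LEAST r. \<exists>H. spanning_subgraph H G \<and> max_degree H = r \<and> \<not> P (delete_edges G H))"

definition has_perfect_matching :: "'a graph \<Rightarrow> bool" where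
  "has_perfect_matching G \<longleftrightarrow> (\<exists>M\<subseteq>edges G. \<forall>v\<in>verts G. \<exists>!e. e \<in> M \<and> v \<in> e)"

definition regular_graphs :: "nat \<Rightarrow> nat \<Rightarrow> nat graph set" where
  "regular_graphs m d =
     {G. simple_graph G \<and> verts G = {1..m} \<and> (\<forall>v\<in>verts G. vertex_degree G v = d)}"

text \<open>This is the uniform distribution only if there is a \<open>d\<close>-regular graph on \<open>m\<close> vertices, and is
  unspecified otherwise. For \<open>m\<close> even, it is uniform whenever \<open>d < m\<close>.\<close>

definition random_regular_graph :: "nat \<Rightarrow> nat \<Rightarrow> nat graph pmf" where
  "random_regular_graph m d = pmf_of_set (regular_graphs m d)"

lemma finite_regular_graphs: "finite (regular_graphs m d)"
proof (rule finite_subset)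
  show "regular_graphs m d \<subseteq> {{1..m}} \<times> Pow (Pow {1..m})"
    unfolding regular_graphs_def simple_graph_def by (force simp del: atLeastAtMost_iff)
qed simp

lemma monotone_increasing_has_perfect_matching: "monotone_increasing has_perfect_matching"
  unfolding monotone_increasing_def has_perfect_matching_def spanning_subgraph_def
  by (metis subset_trans)

lemma local_resilience_perfect_matching_attained:
  assumes "verts G \<noteq> {}"
  shows "\<exists>H. spanning_subgraph H G \<and> max_degree H = local_resilience G has_perfect_matching \<and>
           \<not> has_perfect_matching (delete_edges G H)"
proof -
  have "\<not> has_perfect_matching (delete_edges G G)"
    using assms by (auto simp: has_perfect_matching_def delete_edges_def)
  moreover have "spanning_subgraph G G"
    by (simp add: spanning_subgraph_def)
  ultimately have "\<exists>r. \<exists>H. spanning_subgraph H G \<and> max_degree H = r \<and>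
      \<not> has_perfect_matching (delete_edges G H)"
    by blast
  then show ?thesis
    unfolding local_resilience_def by (rule LeastI_ex)
qed

end

theory Submission
  imports Defs "HOL-Real_Asymp.Real_Asymp"
begin

text \<open>
  Put \<open>l = 2 \<surd>(d ln d)\<close>. The only random input is a bound on edge counts: asymptotically almost surely
  \<open>e(U, S) \<le> d s\<^sup>2 / 2n + l s\<close> (ordered pairs) for all vertex sets with \<open>|U| = |S| = s \<le> n\<close> that are
  equal or disjoint. For fixed \<open>U, S\<close> it comes from double counting switchings
  \<open>uv, xy \<rightarrow> ux, vy\<close> with \<open>u \<in> U\<close>, \<open>v \<in> S\<close>, \<open>x \<notin> S\<close>, \<open>y \<notin> U\<close>, each of which lowers \<open>e(U, S)\<close> by at most 2
  and creates no edge between \<open>U\<close> and \<open>S\<close>. A union bound over all \<open>U, S\<close> finishes.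

  Upper bound: in a maximum cut every vertex has at most \<open>d/2\<close> neighbours on its own side. Let \<open>A\<close> be the
  larger side; if \<open>|A| = n\<close>, add a vertex with at most \<open>d/2 + l\<close> neighbours in \<open>A\<close>, which exists by the edge
  bound. Deleting the edges inside \<open>A\<close> leaves an independent set of more than \<open>n\<close> vertices.

  Lower bound: if \<open>F = G - H\<close> has no perfect matching, Tutte's theorem gives \<open>S\<close>, \<open>|S| = s\<close>, such that \<open>F - S\<close> has at least
  \<open>s + 2\<close> components. All components but the largest have at most \<open>n - s\<close> vertices, so the edge bound
  limits their inner degrees to \<open>d (n - s) / 2n + l\<close> on average; if the minimum degree of \<open>F\<close> exceeded \<open>d/2 + 2 l\<close>, then some
  \<open>s\<close> of their vertices would send more than \<open>s (d s / 2n + l)\<close> edges into \<open>S\<close>.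
\<close>

section \<open>Tutte barriers\<close>

text \<open>A matching is encoded as an involution; its fixed points are the unmatched vertices.\<close>

definition matching_on :: "'a set \<Rightarrow> 'a set set \<Rightarrow> ('a \<Rightarrow> 'a) \<Rightarrow> bool" where
  "matching_on V E m \<longleftrightarrow> (\<forall>v. m (m v) = v) \<and> (\<forall>v. m v \<noteq> v \<longrightarrow> v \<in> V \<and> {v, m v} \<in> E)"

definition perfect_on :: "'a set \<Rightarrow> 'a set set \<Rightarrow> ('a \<Rightarrow> 'a) \<Rightarrow> bool" where
  "perfect_on V E m \<longleftrightarrow> matching_on V E m \<and> (\<forall>v\<in>V. m v \<noteq> v)"

lemma matching_on_invol: "matching_on V E m \<Longrightarrow> m (m v) = v"
  by (simp add: matching_on_def)

lemma matching_on_closed: "matching_on V E m \<Longrightarrow> v \<in> V \<Longrightarrow> m v \<in> V"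
  unfolding matching_on_def by metis

section \<open>Involutions and alternating paths\<close>

lemma even_card_involution:
  assumes "finite A" "\<And>a. a \<in> A \<Longrightarrow> f a \<in> A \<and> f a \<noteq> a \<and> f (f a) = a"
  shows "even (card A)"
proof -
  let ?C = "(\<lambda>a. {a, f a}) ` A"
  have U: "\<Union>?C = A" using assms(2) by auto
  have "2 * card ?C = card (\<Union>?C)"
  proof (rule card_partition)
    show "finite ?C" "finite (\<Union>?C)" using assms(1) U by auto
    show "card c = 2" if "c \<in> ?C" for c
      using that assms(2) by (force simp: card_2_iff)
    show "c1 \<inter> c2 = {}" if "c1 \<in> ?C" "c2 \<in> ?C" "c1 \<noteq> c2" for c1 c2
    proof -
      from that obtain a b where ab: "a \<in> A" "b \<in> A" "c1 = {a, f a}" "c2 = {b, f b}" by blast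
      have "f a = b \<Longrightarrow> a = f b" "f a = f b \<Longrightarrow> a = b"
        using assms(2)[OF ab(1)] assms(2)[OF ab(2)] by metis+
      moreover have "c1 = c2" if "a = b \<or> a = f b"
        using that ab assms(2)[OF ab(2)] by (metis insert_commute)
      ultimately show ?thesis using ab(3,4) \<open>c1 \<noteq> c2\<close> by blast
    qed
  qed
  then show ?thesis using U by (metis dvd_triv_left)
qed

text \<open>With \<open>f = m2 \<circ> m1\<close>, an equality \<open>f^j v = m1 v\<close> says that
  the alternating path from \<open>v\<close> reads the same from both ends. Cutting off both ends
  gives \<open>f^(j-2) (f v) = m1 (f v)\<close>. The descent by two stops at a fixed point of
  \<open>m1\<close> (\<open>j = 0\<close>) or of \<open>m2\<close> (\<open>j = 1\<close>), which the
  hypotheses exclude along the orbit.\<close>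

lemma alternating_orbit_avoids:
  assumes "\<And>v. m1 (m1 v) = v" "\<And>v. m2 (m2 v) = v"
    and "\<And>j. m1 (((m2 \<circ> m1) ^^ j) v) \<noteq> ((m2 \<circ> m1) ^^ j) v"
    and "\<And>j. m2 (m1 (((m2 \<circ> m1) ^^ j) v)) \<noteq> m1 (((m2 \<circ> m1) ^^ j) v)"
  shows "((m2 \<circ> m1) ^^ j) v \<noteq> m1 v"
  using assms(3,4)
proof (induction j arbitrary: v rule: nat_less_induct)
  case (1 j)
  let ?f = "m2 \<circ> m1"
  consider "j = 0" | "j = 1" | k where "j = Suc (Suc k)"
    by (metis One_nat_def not0_implies_Suc)
  then show ?case
  proof cases
    case 1
    then show ?thesis using "1.prems"(1)[of 0] by auto
  next
    case 2
    then show ?thesis using "1.prems"(2)[of 0] by auto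
  next
    case 3
    have sh: "(?f ^^ i) (?f v) = (?f ^^ Suc i) v" for i
      by (simp only: funpow_Suc_right comp_apply)
    have "(?f ^^ k) (?f v) \<noteq> m1 (?f v)"
      using "1.IH" 3 "1.prems" unfolding sh[symmetric]
      by (metis (no_types, lifting) lessI less_SucI sh)
    then have "(?f ^^ Suc k) v \<noteq> m1 (?f v)" by (simp only: sh not_False_eq_True)
    then have *: "m1 ((?f ^^ Suc k) v) \<noteq> m2 (m1 v)"
      using assms(1)[of "(?f ^^ Suc k) v"] by auto
    have "(?f ^^ j) v = m2 (m1 ((?f ^^ Suc k) v))" using 3 by simp
    then show ?thesis using * assms(2)[of "m1 ((?f ^^ Suc k) v)"] by force
  qed
qed

text \<open>Follow the alternating path from \<open>w\<close> until it meets \<open>x\<close>, \<open>z\<close> or closes up at \<open>y\<close>. In the first case the path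
  together with one of the edges \<open>xy\<close>, \<open>zy\<close> is rematched, in the second the two matchings are swapped along the cycle.\<close>

lemma exchange_perfect:
  assumes fin: "finite V"
    and m1: "perfect_on V (insert {x, z} E) m1" and m2: "perfect_on V (insert {y, w} E) m2"
    and V: "x \<in> V" "z \<in> V" "y \<in> V" "w \<in> V"
    and E: "{x, y} \<in> E" "{y, z} \<in> E" and ne: "x \<noteq> y" "y \<noteq> z" "x \<noteq> z" "y \<noteq> w"
  shows "\<exists>m. perfect_on V E m"
proof (cases "m1 x = z \<and> m2 y = w")
  case False
  have i1: "m1 (m1 v) = v" and i2: "m2 (m2 v) = v" for v
    using m1 m2 by (auto simp: perfect_on_def matching_on_def)
  \<comment> \<open>A matching that avoids its added edge is already perfect in \<open>E\<close>, so
    only the case where both added edges are used remains.\<close>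
  have "perfect_on V E m1" if "m1 x \<noteq> z"
    using m1 that i1 unfolding perfect_on_def matching_on_def
    by (auto simp: doubleton_eq_iff)
  moreover have "perfect_on V E m2" if "m2 y \<noteq> w"
    using m2 that i2 unfolding perfect_on_def matching_on_def
    by (auto simp: doubleton_eq_iff)
  ultimately show ?thesis using False by blast
next
  case True
  have i1: "m1 (m1 v) = v" and i2: "m2 (m2 v) = v" for v
    using m1 m2 by (auto simp: perfect_on_def matching_on_def)
  have xz: "m1 x = z" "m1 z = x" and yw: "m2 y = w" "m2 w = y"
    using True i1 i2 by auto
  have V1: "v \<in> V \<longleftrightarrow> m1 v \<noteq> v" "v \<in> V \<longleftrightarrow> m2 v \<noteq> v" for v
    using m1 m2 unfolding perfect_on_def matching_on_def by blast+
  have c1: "v \<in> V \<longleftrightarrow> m1 v \<in> V" and c2: "v \<in> V \<longleftrightarrow> m2 v \<in> V" for v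
    using V1 i1 i2 by metis+
  have e1: "{v, m1 v} \<in> E" if "v \<in> V" "v \<noteq> x" "v \<noteq> z" for v
    using m1 that by (auto simp: perfect_on_def matching_on_def doubleton_eq_iff)
  have e2: "{v, m2 v} \<in> E" if "v \<in> V" "v \<noteq> y" "v \<noteq> w" for v
    using m2 that by (auto simp: perfect_on_def matching_on_def doubleton_eq_iff)
  \<comment> \<open>\<open>p i\<close> and \<open>m1 (p i)\<close> are the successive vertices of
    the alternating path that leaves \<open>w\<close> by its \<open>m1\<close>-edge; since
    \<open>m2 w = y\<close>, the vertex \<open>y\<close> precedes it.\<close>
  define p where "p i = ((m2 \<circ> m1) ^^ i) w" for i
  have p0: "p 0 = w" and pS: "p (Suc i) = m2 (m1 (p i))" for i by (auto simp: p_def)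
  have pV: "p i \<in> V" for i
    by (induction i) (use p0 pS V c1 c2 in auto)
  \<comment> \<open>An injective orbit in a finite set returns to \<open>w\<close>; just before
    that, \<open>m1 (p k')\<close> is the \<open>m2\<close>-partner of \<open>w\<close>, namely
    \<open>y\<close>. Hence the path does stop.\<close>
  have inj: "inj (m2 \<circ> m1)"
    by (metis (no_types, lifting) comp_apply i1 i2 injI)
  have "finite {u. \<exists>n. u = ((m2 \<circ> m1) ^^ n) w}"
    by (rule finite_subset[OF _ fin]) (use pV in \<open>auto simp: p_def\<close>)
  from funpow_inj_finite[OF inj this] obtain k where k: "k > 0" "p k = w"
    by (auto simp: p_def)
  then obtain k' where "k = Suc k'" by (cases k) auto
  then have "m1 (p k') = y" using k pS i2 yw by metis
  then have ex: "\<exists>i. p i \<in> {x, z} \<or> m1 (p i) = y" by blast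
  define i where "i = (LEAST i. p i \<in> {x, z} \<or> m1 (p i) = y)"
  have i: "p i \<in> {x, z} \<or> m1 (p i) = y"
    unfolding i_def using LeastI_ex[OF ex] .
  have lt: "p j \<noteq> x" "p j \<noteq> z" "m1 (p j) \<noteq> y" if "j < i" for j
    using not_less_Least[OF that[unfolded i_def]] by auto
  have nw: "p j \<noteq> m1 w" for j
    unfolding p_def
    by (rule alternating_orbit_avoids) (use i1 i2 V1 c1 c2 pV in \<open>auto simp: p_def[symmetric]\<close>)
  \<comment> \<open>\<open>p (Suc j) = y = m2 w\<close> would force
    \<open>p j = m1 w\<close>.\<close>
  have ny: "p j \<noteq> y" for j
    by (cases j) (use p0 pS nw yw i1 i2 ne in \<open>metis\<close>)+
  show ?thesis
  proof (cases "p i \<in> {x, z}")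
    case True
    \<comment> \<open>\<open>W\<close> is the path before \<open>p i\<close>, a union of
      \<open>m1\<close>-edges. With \<open>y\<close> and \<open>p i\<close> added it is closed under
      \<open>m2\<close> too, which pairs \<open>y\<close> with \<open>w = p 0\<close> and
      \<open>m1 (p j)\<close> with \<open>p (Suc j)\<close>. So \<open>m1\<close> serves on
      \<open>W\<close>, \<open>m2\<close> outside, and the edge from \<open>p i\<close>, which is
      \<open>x\<close> or \<open>z\<close>, to \<open>y\<close> covers the two vertices left
      over.\<close>
    define W where "W = (\<Union>j<i. {p j, m1 (p j)})"
    have "m1 v \<in> W" if "v \<in> W" for v using that i1 unfolding W_def by auto
    then have W1: "m1 v \<in> W \<longleftrightarrow> v \<in> W" for v using i1 by metis
    have yW: "y \<notin> W" using lt ny unfolding W_def by auto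
    have xW: "x \<notin> W" "z \<notin> W" using lt xz i1 unfolding W_def by fastforce+
    have piW: "p i \<notin> W" using True xW by auto
    have piy: "p i \<noteq> y" by (rule ny)
    have Wp: "p j \<in> W" "m1 (p j) \<in> W" if "j < i" for j
      using that unfolding W_def by blast+
    let ?T = "W \<union> {y, p i}"
    have pT: "p j \<in> ?T" if "j \<le> i" for j
      using Wp(1)[of j] that by (cases "j = i") auto
    have A: "m2 (p j) \<in> ?T" if "j \<le> i" for j
    proof (cases j)
      case 0 then show ?thesis using p0 yw by auto
    next
      case (Suc j')
      then show ?thesis using that pS[of j'] i2[of "m1 (p j')"] Wp(2)[of j'] by simp
    qed
    have B: "m2 (m1 (p j)) \<in> ?T" if "j < i" for j
      using pT[of "Suc j"] that by (simp add: pS)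
    have C: "m2 y \<in> ?T" using pT[of 0] p0 yw by simp
    have T2: "m2 u \<in> ?T" if "u \<in> ?T" for u
    proof -
      consider j where "j < i" "u = p j \<or> u = m1 (p j)" | "u = y" | "u = p i"
        using \<open>u \<in> ?T\<close> unfolding W_def by blast
      then show ?thesis using A[of _] A[of i] B C by cases (metis less_imp_le, blast+)
    qed
    have m2W: "v \<in> ?T" if "m2 v \<in> ?T" for v
      using T2[OF that] i2[of v] by simp
    define m where "m v = (if v \<in> W then m1 v else if v = y then p i else if v = p i then y else m2 v)" for v
    have WV: "W \<subseteq> V" unfolding W_def using pV c1 by auto
    have inv: "m (m v) = v" for v
      using W1 m2W[of v] i1 i2 yW piW piy unfolding m_def by auto
    have piE: "{p i, y} \<in> E" "{y, p i} \<in> E" using True E by (auto simp: insert_commute)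
    have edge: "v \<in> V \<and> {v, m v} \<in> E" if "m v \<noteq> v" for v
    proof -
      consider "v \<in> W" | "v = y" | "v = p i" | "v \<notin> W \<union> {y, p i}" by auto
      then show ?thesis
      proof cases
        case 1
        then show ?thesis using e1 xW WV by (auto simp: m_def)
      next
        case 2
        then show ?thesis using yW piE V by (auto simp: m_def)
      next
        case 3
        then show ?thesis using piW piE pV piy by (auto simp: m_def)
      next
        case 4
        then have "m v = m2 v" by (auto simp: m_def)
        moreover have "v \<noteq> w" using 4 m2W[of w] yw by auto
        ultimately show ?thesis using 4 e2 that V1 by auto
      qed
    qed
    have "m v \<noteq> v" if "v \<in> V" for v
      using that V1 piy unfolding m_def by auto
    then show ?thesis using inv edge unfolding perfect_on_def matching_on_def by blast
  next
    case False
    then have piy: "m1 (p i) = y" using i by auto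
    \<comment> \<open>The path closes up through \<open>y\<close> and \<open>m2 y = w\<close>, so
      \<open>W\<close> is closed under both matchings. It contains \<open>y\<close> and
      \<open>w\<close> but neither \<open>x\<close> nor \<open>z\<close>, hence \<open>m1\<close> on
      \<open>W\<close> and \<open>m2\<close> elsewhere avoid both added edges.\<close>
    define W where "W = (\<Union>j\<le>i. {p j, m1 (p j)})"
    have "m1 v \<in> W" if "v \<in> W" for v using that i1 unfolding W_def by auto
    then have W1: "m1 v \<in> W \<longleftrightarrow> v \<in> W" for v using i1 by metis
    have "p j \<notin> {x, z}" if "j \<le> i" for j
      using lt[of j] that False by (cases "j = i") auto
    then have lt': "p j \<noteq> x" "p j \<noteq> z" if "j \<le> i" for j
      using that by blast+
    have xW: "x \<notin> W" "z \<notin> W" using lt' xz i1 unfolding W_def by fastforce+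
    have yW: "y \<in> W" "w \<in> W" using piy p0 unfolding W_def by fastforce+
    have Wp: "p j \<in> W" "m1 (p j) \<in> W" if "j \<le> i" for j
      using that unfolding W_def by blast+
    have A: "m2 (p j) \<in> W" if "j \<le> i" for j
    proof (cases j)
      case 0 then show ?thesis using p0 yw yW by auto
    next
      case (Suc j')
      then show ?thesis using that pS[of j'] i2[of "m1 (p j')"] Wp(2)[of j'] by simp
    qed
    have B: "m2 (m1 (p j)) \<in> W" if "j \<le> i" for j
      using Wp(1)[of "Suc j"] that piy yw yW pS[of j] by (cases "j = i") auto
    have T2: "m2 u \<in> W" if "u \<in> W" for u
    proof -
      obtain j where "j \<le> i" "u = p j \<or> u = m1 (p j)"
        using \<open>u \<in> W\<close> unfolding W_def by blast
      then show ?thesis using A B by auto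
    qed
    have m2W: "v \<in> W" if "m2 v \<in> W" for v
      using T2[OF that] i2[of v] by simp
    define m where "m v = (if v \<in> W then m1 v else m2 v)" for v
    have WV: "W \<subseteq> V" unfolding W_def using pV c1 by auto
    have inv: "m (m v) = v" for v
      using W1 m2W[of v] i1 i2 unfolding m_def by auto
    have edge: "v \<in> V \<and> {v, m v} \<in> E" if "m v \<noteq> v" for v
    proof (cases "v \<in> W")
      case True
      then show ?thesis using e1 xW WV by (auto simp: m_def)
    next
      case False
      then show ?thesis using e2 yW that V1 by (auto simp: m_def)
    qed
    have "m v \<noteq> v" if "v \<in> V" for v
      using that V1 unfolding m_def by auto
    then show ?thesis using inv edge unfolding perfect_on_def matching_on_def by blast
  qed
qed

section \<open>Augmenting paths\<close>

text \<open>Common form of the augmentations below: \<open>W\<close> is the vertex set of an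
  alternating path with unmatched ends, \<open>g\<close> its rematching. Vertices outside
  \<open>W\<close> keep their partners and \<open>w\<close> gains one, so the set of unmatched
  vertices shrinks strictly.\<close>

lemma matching_override:
  assumes m: "matching_on V E m" and W: "W \<subseteq> V" "\<And>v. v \<in> W \<Longrightarrow> m v \<in> W"
    and g: "\<And>v. v \<in> W \<Longrightarrow> g v \<in> W \<and> g (g v) = v \<and> g v \<noteq> v \<and> {v, g v} \<in> E"
    and w: "w \<in> W" "m w = w"
  shows "\<exists>m'. matching_on V E m' \<and> {v \<in> V. m' v = v} \<subset> {v \<in> V. m v = v}"
proof -
  define m' where "m' v = (if v \<in> W then g v else m v)" for v
  have inv: "m (m v) = v" for v using m by (rule matching_on_invol)
  have W': "m v \<in> W \<longleftrightarrow> v \<in> W" for v using W(2)[of v] W(2)[of "m v"] inv[of v] by auto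
  have "m' (m' v) = v" for v
    using g[of v] W'[of v] inv[of v] by (auto simp: m'_def)
  moreover have "v \<in> V \<and> {v, m' v} \<in> E" if "m' v \<noteq> v" for v
    using that g[of v] W(1) m by (auto simp: m'_def matching_on_def split: if_splits)
  ultimately have "matching_on V E m'"
    unfolding matching_on_def by blast
  moreover have "{v \<in> V. m' v = v} \<subseteq> {v \<in> V. m v = v} - {w}"
    using g w by (auto simp: m'_def split: if_splits)
  ultimately show ?thesis using w W(1) by blast
qed

lemma augment_edge:
  assumes m: "matching_on V E m" and "a \<in> V" "b \<in> V" "m a = a" "m b = b" "a \<noteq> b" "{a, b} \<in> E"
  shows "\<exists>m'. matching_on V E m' \<and> {v \<in> V. m' v = v} \<subset> {v \<in> V. m v = v}"
  by (rule matching_override[OF m, of "{a, b}" "id(a := b, b := a)" a])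
    (use assms in \<open>auto simp: insert_commute\<close>)

text \<open>Flips the path \<open>a\<close>, \<open>s\<close>, \<open>m s\<close>,
  \<open>b\<close>.\<close>

lemma augment_path3:
  assumes m: "matching_on V E m" and V: "a \<in> V" "b \<in> V" "s \<in> V" and
    ab: "m a = a" "m b = b" "a \<noteq> b" and s: "m s \<noteq> s" and E: "{a, s} \<in> E" "{m s, b} \<in> E"
  shows "\<exists>m'. matching_on V E m' \<and> {v \<in> V. m' v = v} \<subset> {v \<in> V. m v = v}"
proof -
  have inv: "m (m s) = s" using m by (rule matching_on_invol)
  have ne: "a \<noteq> s" "b \<noteq> s" "a \<noteq> m s" "b \<noteq> m s"
    using ab s inv by metis+
  have "m s \<in> V" using m V(3) by (rule matching_on_closed)
  then show ?thesis
    by (intro matching_override[OF m, of "{a, b, s, m s}" "id(a := s, s := a, m s := b, b := m s)" a])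
      (use ab s E V ne ne[symmetric] inv in \<open>auto simp: insert_commute\<close>)
qed

text \<open>Flips the path \<open>a\<close>, \<open>s\<close>, \<open>m s\<close>,
  \<open>m t\<close>, \<open>t\<close>, \<open>b\<close>; \<open>s \<noteq> t\<close> and
  \<open>m s \<noteq> t\<close> keep its two matching edges distinct.\<close>

lemma augment_path5:
  assumes m: "matching_on V E m" and V: "a \<in> V" "b \<in> V" "s \<in> V" "t \<in> V" and
    ab: "m a = a" "m b = b" "a \<noteq> b" and st: "m s \<noteq> s" "m t \<noteq> t" "s \<noteq> t" "m s \<noteq> t"
    and E: "{a, s} \<in> E" "{m s, m t} \<in> E" "{t, b} \<in> E"
  shows "\<exists>m'. matching_on V E m' \<and> {v \<in> V. m' v = v} \<subset> {v \<in> V. m v = v}"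
proof -
  have inv: "m (m s) = s" "m (m t) = t" using m by (auto intro: matching_on_invol)
  have ne: "a \<noteq> s" "b \<noteq> s" "a \<noteq> m s" "b \<noteq> m s" "a \<noteq> t" "b \<noteq> t" "a \<noteq> m t" "b \<noteq> m t"
    "s \<noteq> m t" "m s \<noteq> m t"
    using ab st inv by metis+
  have "m s \<in> V" "m t \<in> V" using m V by (auto intro: matching_on_closed)
  then show ?thesis
    by (intro matching_override[OF m, of "{a, b, s, m s, t, m t}"
          "id(a := s, s := a, m s := m t, m t := m s, t := b, b := t)" a])
      (use ab st E V ne ne[symmetric] st(3,4)[symmetric] inv in \<open>auto simp: insert_commute\<close>)
qed

text \<open>Lovasz's argument: in an edge-maximal graph without perfect matching, adjacency is transitive outside
  the set \<open>S\<close> of universal vertices. In a maximum matching there, the partners of \<open>S\<close> and the unmatched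
  vertices (at least two, by parity) lie in pairwise distinct cliques, since otherwise a short augmenting path exists.\<close>

lemma no_perfect_matching_barrier:
  fixes V :: "'a set"
  assumes fin: "finite V" and ev: "even (card V)" and E: "\<And>e. e \<in> E \<Longrightarrow> e \<subseteq> V \<and> card e = 2"
    and no: "\<nexists>m. perfect_on V E m"
  obtains S :: "'a set" and c :: "'a \<Rightarrow> 'a set" where "S \<subseteq> V"
    "\<And>u v. u \<in> V - S \<Longrightarrow> v \<in> V - S \<Longrightarrow> {u, v} \<in> E \<Longrightarrow> c u = c v"
    "card S + 2 \<le> card (c ` (V - S))"
proof -
  let ?K = "{e. e \<subseteq> V \<and> card e = 2}"
  \<comment> \<open>Enlarging \<open>E\<close> to a maximal \<open>F\<close> only adds constraints
    on the labelling \<open>c\<close>, so a barrier for \<open>F\<close> also serves for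
    \<open>E\<close>.\<close>
  let ?EE = "{E'. E' \<subseteq> ?K \<and> (\<nexists>m. perfect_on V E' m)}"
  have "finite ?EE" using fin by simp
  moreover have "E \<in> ?EE" using E no by auto
  ultimately have "\<exists>F\<in>?EE. E \<subseteq> F \<and> (\<forall>E'\<in>?EE. F \<subseteq> E' \<longrightarrow> F = E')"
    by (rule finite_has_maximal2)
  then obtain F where F: "F \<in> ?EE" "E \<subseteq> F" and max': "\<forall>E'\<in>?EE. F \<subseteq> E' \<longrightarrow> F = E'"
    by (elim bexE conjE)
  have max: "F = E'" if "E' \<subseteq> ?K" "\<nexists>m. perfect_on V E' m" "F \<subseteq> E'" for E'
    using max' that by simp
  have FK: "F \<subseteq> ?K" and Fno: "\<nexists>m. perfect_on V F m" using F(1) by auto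
  have F2: "a \<noteq> b" "a \<in> V" "b \<in> V" if "{a, b} \<in> F" for a b
  proof -
    have "{a, b} \<in> ?K" using FK that by (rule subsetD)
    then have "{a, b} \<subseteq> V" "card {a, b} = 2" by auto
    then show "a \<noteq> b" "a \<in> V" "b \<in> V" by auto
  qed
  have add: "\<exists>m. perfect_on V (insert {a, b} F) m" if "a \<in> V" "b \<in> V" "a \<noteq> b" "{a, b} \<notin> F" for a b
  proof (rule ccontr)
    assume "\<nexists>m. perfect_on V (insert {a, b} F) m"
    moreover have "insert {a, b} F \<subseteq> ?K" using FK that by auto
    ultimately have "F = insert {a, b} F" using max[of "insert {a, b} F"] by blast
    then show False using that(4) by blast
  qed
  define S where "S = {v \<in> V. \<forall>u\<in>V. u \<noteq> v \<longrightarrow> {u, v} \<in> F}"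
  have trans: "{x, z} \<in> F" if h: "y \<in> V - S" "{x, y} \<in> F" "{y, z} \<in> F" "x \<noteq> z" for x y z
  proof (rule ccontr)
    assume n: "{x, z} \<notin> F"
    \<comment> \<open>\<open>y\<close> is not universal. By maximality, adding either
      \<open>xz\<close> or \<open>yw\<close> creates a perfect matching, and
      \<open>exchange_perfect\<close> then produces one in \<open>F\<close> itself.\<close>
    obtain w where w: "w \<in> V" "w \<noteq> y" "{w, y} \<notin> F" using h(1) unfolding S_def by auto
    have V: "x \<in> V" "y \<in> V" "z \<in> V" "x \<noteq> y" "y \<noteq> z" using F2 h by blast+
    obtain m1 where "perfect_on V (insert {x, z} F) m1" using add[of x z] n V h by blast
    moreover obtain m2 where "perfect_on V (insert {y, w} F) m2"
      using add[of y w] w V by (metis insert_commute)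
    ultimately have "\<exists>m. perfect_on V F m"
      using exchange_perfect[OF fin, of x z F m1 y w m2] V w h by blast
    then show False using Fno by blast
  qed
  \<comment> \<open>By transitivity the component of \<open>v\<close> outside \<open>S\<close> is
    its closed neighbourhood there; the component itself is used as the label.\<close>
  define c where "c v = {u \<in> V - S. u = v \<or> {u, v} \<in> F}" for v
  have c1: "c u = c v" if uv: "u \<in> V - S" "v \<in> V - S" "{u, v} \<in> F" for u v
  proof -
    have "c u \<subseteq> c v" if "u \<in> V - S" "v \<in> V - S" "{u, v} \<in> F" for u v
      unfolding c_def using trans[of u _ v] that by (auto simp: insert_commute)
    then show ?thesis using uv by (metis insert_commute subset_antisym)
  qed
  have c2: "u = v \<or> {u, v} \<in> F" if "c u = c v" "u \<in> V - S" for u v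
    using that unfolding c_def by blast
  have SE: "{s, v} \<in> F" if "s \<in> S" "v \<in> V" "s \<noteq> v" for s v
    using that unfolding S_def by (auto simp: insert_commute)
  have "matching_on V F id" by (simp add: matching_on_def)
  then have "\<exists>m. matching_on V F m \<and>
      (\<forall>m'. matching_on V F m' \<longrightarrow> card {v \<in> V. m v = v} \<le> card {v \<in> V. m' v = v})"
    using ex_has_least_nat[of "matching_on V F" id "\<lambda>m. card {v \<in> V. m v = v}"] by simp
  then obtain m where m: "matching_on V F m" and
    mmin: "\<forall>m'. matching_on V F m' \<longrightarrow> card {v \<in> V. m v = v} \<le> card {v \<in> V. m' v = v}"
    by (elim exE conjE)
  have noaug: False if h: "\<exists>m'. matching_on V F m' \<and> {v \<in> V. m' v = v} \<subset> {v \<in> V. m v = v}"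
  proof -
    obtain m' where m': "matching_on V F m'" "{v \<in> V. m' v = v} \<subset> {v \<in> V. m v = v}"
      using h by (elim exE conjE)
    then have "card {v \<in> V. m' v = v} < card {v \<in> V. m v = v}"
      using fin by (intro psubset_card_mono) auto
    then show False using mmin m'(1) by (simp add: leD)
  qed
  define Z where "Z = {v \<in> V. m v = v}"
  have inv: "m (m v) = v" for v using m by (rule matching_on_invol)
  have cl: "v \<in> V \<Longrightarrow> m v \<in> V" for v using m by (rule matching_on_closed)
  \<comment> \<open>Matched vertices come in pairs and \<open>card V\<close> is even, so the number
    of unmatched ones is even and positive.\<close>
  have "Z \<noteq> {}"
    using Fno m unfolding Z_def perfect_on_def by blast
  moreover have "even (card (V - Z))"
    by (rule even_card_involution[of _ m]) (use fin inv cl in \<open>auto simp: Z_def\<close>)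
  moreover have finZ: "finite Z" and "Z \<subseteq> V" using fin by (auto simp: Z_def)
  then have "card V = card (V - Z) + card Z"
    using fin by (metis card_Diff_subset card_mono le_add_diff_inverse2)
  ultimately have "card Z \<noteq> 0" "even (card Z)" using ev finZ by auto
  then have Z2: "2 \<le> card Z" by presburger
  have other: "\<exists>b\<in>Z. b \<noteq> a" for a
    using Z2 finZ by (metis One_nat_def card_le_Suc0_iff_eq not_less_eq_eq numeral_2_eq_2)
  have Zind: "{a, b} \<notin> F" if "a \<in> Z" "b \<in> Z" "a \<noteq> b" for a b
    using augment_edge[OF m, of a b] noaug that unfolding Z_def by blast
  have p3: False if "a \<in> Z" "b \<in> Z" "a \<noteq> b" "s \<in> V" "m s \<noteq> s" "{a, s} \<in> F" "{m s, b} \<in> F" for a b s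
    using augment_path3[OF m, of a b s] noaug that unfolding Z_def by blast
  have p5: False if "a \<in> Z" "b \<in> Z" "a \<noteq> b" "s \<in> V" "t \<in> V" "m s \<noteq> s" "m t \<noteq> t" "s \<noteq> t" "m s \<noteq> t"
    "{a, s} \<in> F" "{m s, m t} \<in> F" "{t, b} \<in> F" for a b s t
    using augment_path5[OF m, of a b s t] noaug that unfolding Z_def by blast
  have SZ: "S \<inter> Z = {}"
  proof (rule ccontr)
    assume "S \<inter> Z \<noteq> {}"
    then obtain a where a: "a \<in> S" "a \<in> Z" by blast
    obtain b where "b \<in> Z" "b \<noteq> a" using other by blast
    then show False using Zind[of a b] SE[of a b] a by (auto simp: Z_def)
  qed
  have SV: "S \<subseteq> V" by (auto simp: S_def)
  have mS: "m s \<noteq> s" "m s \<in> V" if "s \<in> S" for s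
    using that SZ SV cl by (auto simp: Z_def)
  have SZF: "{s, a} \<in> F" "{a, s} \<in> F" if "s \<in> S" "a \<in> Z" for s a
    using SE[of s a] that SZ by (auto simp: Z_def insert_commute)
  \<comment> \<open>If \<open>s\<close> and \<open>m s\<close> were both universal,
    \<open>a\<close>, \<open>s\<close>, \<open>m s\<close>, \<open>b\<close> would be an augmenting
    path for any two unmatched \<open>a\<close>, \<open>b\<close>.\<close>
  have mSR: "m s \<in> V - S" if "s \<in> S" for s
  proof (rule ccontr)
    assume "m s \<notin> V - S"
    then have ms: "m s \<in> S" using mS that by blast
    obtain a where a: "a \<in> Z" using Z2 by fastforce
    obtain b where b: "b \<in> Z" "b \<noteq> a" using other by blast
    show False using p3[of a b s] a b SZF mS that SV ms by blast
  qed
  \<comment> \<open>An unmatched vertex represents itself, a vertex of \<open>S\<close> is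
    represented by its partner. These \<open>card S + card Z\<close> representatives turn out to lie
    in distinct cliques.\<close>
  define g where "g v = (if v \<in> Z then v else m v)" for v
  have gZ: "g v = v" if "v \<in> Z" for v using that by (simp add: g_def)
  have gS: "g v = m v" if "v \<in> S" for v using that SZ by (auto simp: g_def)
  have gR: "g v \<in> V - S" if "v \<in> S \<union> Z" for v
    using that mSR SZ by (auto simp: g_def Z_def)
  have ZS_diff: "c a \<noteq> c (m s)" if "a \<in> Z" "s \<in> S" for a s
  proof
    assume "c a = c (m s)"
    then have "a = m s \<or> {m s, a} \<in> F" using c2[of a "m s"] that SZ by (auto simp: Z_def insert_commute)
    moreover have "a \<noteq> m s" using that inv mS by (metis (mono_tags, lifting) Z_def mem_Collect_eq)
    moreover obtain b where "b \<in> Z" "b \<noteq> a" using other by blast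
    ultimately show False using p3[of b a s] that SZF mS SV by blast
  qed
  have "inj_on (\<lambda>v. c (g v)) (S \<union> Z)"
  proof (rule inj_onI)
    fix s t assume st: "s \<in> S \<union> Z" "t \<in> S \<union> Z" "c (g s) = c (g t)"
    show "s = t"
    proof (rule ccontr)
      assume ne: "s \<noteq> t"
      consider "s \<in> Z" "t \<in> Z" | "s \<in> Z" "t \<in> S" | "s \<in> S" "t \<in> Z" | "s \<in> S" "t \<in> S"
        using st by blast
      then show False
      proof cases
        case 1
        then have "s = t \<or> {s, t} \<in> F" using c2[of s t] st SZ by (auto simp: g_def Z_def)
        then show False using Zind 1 ne by blast
      next
        case 2
        then show False using ZS_diff[of s t] st(3) by (simp add: gZ gS)
      next
        case 3
        then show False using ZS_diff[of t s] st(3) by (simp add: gZ gS)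
      next
        case 4
        then have "c (m s) = c (m t)" using st(3) by (simp add: gS)
        then have "m s = m t \<or> {m s, m t} \<in> F" using c2 mSR 4 by blast
        then have mst: "{m s, m t} \<in> F" using inv ne by metis
        obtain a where a: "a \<in> Z" using Z2 by fastforce
        obtain b where b: "b \<in> Z" "b \<noteq> a" using other by blast
        have "m s \<noteq> t" using mSR[of s] 4 by blast
        then show False using p5[of a b s t] a b SZF mS mst 4 SV ne by blast
      qed
    qed
  qed
  then have "card ((\<lambda>v. c (g v)) ` (S \<union> Z)) = card (S \<union> Z)" by (rule card_image)
  moreover have "card (S \<union> Z) = card S + card Z"
    using SZ finZ SV fin by (intro card_Un_disjoint) (auto dest: finite_subset)
  moreover have "card ((\<lambda>v. c (g v)) ` (S \<union> Z)) \<le> card (c ` (V - S))"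
    using gR fin by (intro card_mono) auto
  ultimately have "card S + 2 \<le> card (c ` (V - S))" using Z2 by linarith
  then show ?thesis using that[of S c] SV c1 F(2) by blast
qed

section \<open>Edge counts and resilience\<close>

text \<open>Ordered pairs: for \<open>A = B\<close> every edge counts twice, so the count is the sum
  of \<open>nbrs\<close> over \<open>A\<close> in all cases.\<close>

definition edge_pairs :: "'a set set \<Rightarrow> 'a set \<Rightarrow> 'a set \<Rightarrow> ('a \<times> 'a) set" where
  "edge_pairs E A B = {(a, b). a \<in> A \<and> b \<in> B \<and> {a, b} \<in> E}"

abbreviation nbrs :: "'a set set \<Rightarrow> 'a set \<Rightarrow> 'a \<Rightarrow> nat" where
  "nbrs E B a \<equiv> card {b \<in> B. {a, b} \<in> E}"

lemma finite_edge_pairs: "finite A \<Longrightarrow> finite B \<Longrightarrow> finite (edge_pairs E A B)"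
  by (rule finite_subset[of _ "A \<times> B"]) (auto simp: edge_pairs_def)

lemma card_edge_pairs:
  assumes "finite A" "finite B"
  shows "card (edge_pairs E A B) = (\<Sum>a\<in>A. nbrs E B a)"
proof -
  have "edge_pairs E A B = (SIGMA a:A. {b \<in> B. {a, b} \<in> E})"
    by (auto simp: edge_pairs_def)
  then show ?thesis using assms by (simp add: card_SigmaI)
qed

lemma card_edge_pairs_swap: "card (edge_pairs E A B) = card (edge_pairs E B A)"
  by (rule bij_betw_same_card[of prod.swap])
    (auto simp: bij_betw_def edge_pairs_def inj_on_def insert_commute image_def)

lemma nbrs_disjoint_Un:
  assumes "finite B" "finite C" "B \<inter> C = {}"
  shows "nbrs E (B \<union> C) a = nbrs E B a + nbrs E C a"
proof -
  have "{b \<in> B \<union> C. {a, b} \<in> E} = {b \<in> B. {a, b} \<in> E} \<union> {b \<in> C. {a, b} \<in> E}" by auto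
  then show ?thesis using assms by (simp, subst card_Un_disjoint) auto
qed

definition edges_on :: "'a set \<Rightarrow> 'a set set \<Rightarrow> bool" where
  "edges_on V E \<longleftrightarrow> (\<forall>e\<in>E. e \<subseteq> V \<and> card e = 2)"

lemma edges_on_pair: "edges_on V E \<Longrightarrow> {a, b} \<in> E \<Longrightarrow> a \<in> V \<and> b \<in> V \<and> a \<noteq> b"
  unfolding edges_on_def by (auto dest!: bspec simp: card_insert_if split: if_splits)

lemma card_incident_edges:
  assumes "edges_on V E"
  shows "card {e \<in> E. v \<in> e} = nbrs E V v"
proof -
  have "bij_betw (\<lambda>b. {v, b}) {b \<in> V. {v, b} \<in> E} {e \<in> E. v \<in> e}"
  proof (rule bij_betwI')
    show "\<exists>b\<in>{b \<in> V. {v, b} \<in> E}. e = {v, b}" if "e \<in> {e \<in> E. v \<in> e}" for e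
    proof -
      have "card e = 2" "e \<subseteq> V" "v \<in> e" "e \<in> E" using that assms by (auto simp: edges_on_def)
      then obtain b where "e = {v, b}" by (auto simp: card_2_iff)
      then show ?thesis using \<open>e \<subseteq> V\<close> \<open>e \<in> E\<close> by auto
    qed
  qed (auto simp: doubleton_eq_iff)
  then show ?thesis by (auto dest: bij_betw_same_card)
qed

text \<open>The quadratic term is roughly the expected count in a random \<open>d\<close>-regular
  graph, and \<open>l\<close> is the excess allowed per vertex of \<open>S\<close>. Equal sets
  control degrees inside a set, disjoint ones the edges across.\<close>

definition pseudorandom :: "'a set \<Rightarrow> nat \<Rightarrow> real \<Rightarrow> 'a set set \<Rightarrow> bool" where
  "pseudorandom V d l E \<longleftrightarrow> (\<forall>U S. U \<subseteq> V \<longrightarrow> S \<subseteq> V \<longrightarrow> card U = card S \<longrightarrow> (U = S \<or> U \<inter> S = {}) \<longrightarrow>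
     1 \<le> card S \<longrightarrow> 2 * card S \<le> card V \<longrightarrow>
     real (card (edge_pairs E U S)) \<le> real d * real (card S) ^ 2 / real (card V) + l * real (card S))"

lemma pseudorandomD:
  assumes "pseudorandom V d l E" "U \<subseteq> V" "S \<subseteq> V" "card U = card S" "U = S \<or> U \<inter> S = {}"
    "1 \<le> card S" "2 * card S \<le> card V"
  shows "real (card (edge_pairs E U S)) \<le> real d * real (card S) ^ 2 / real (card V) + l * real (card S)"
  using assms unfolding pseudorandom_def by blast

lemma finite_arg_max:
  fixes f :: "'a \<Rightarrow> 'b::linorder"
  assumes "finite A" "A \<noteq> {}"
  shows "\<exists>a\<in>A. \<forall>b\<in>A. f b \<le> f a"
proof -
  have "Max (f ` A) \<in> f ` A" using assms by (intro Max_in) auto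
  then obtain a where "a \<in> A" "f a = Max (f ` A)" by auto
  then show ?thesis using assms by (intro bexI[of _ a]) auto
qed

text \<open>Discarding a least element never lowers the average; the averages are compared after
  cross-multiplication.\<close>

lemma subset_with_large_average:
  fixes f :: "'a \<Rightarrow> real"
  assumes "finite U" "s \<le> card U"
  shows "\<exists>W\<subseteq>U. card W = s \<and> real s * sum f U \<le> real (card U) * sum f W"
  using assms
proof (induction "card U" arbitrary: U rule: less_induct)
  case less
  show ?case
  proof (cases "s = card U")
    case True
    then show ?thesis by blast
  next
    case False
    then have lt: "s < card U" using less.prems by simp
    then have ne: "U \<noteq> {}" by auto
    obtain u where u: "u \<in> U" "\<And>v. v \<in> U \<Longrightarrow> f u \<le> f v"
      using finite_arg_max[of U "\<lambda>v. - f v"] less.prems(1) ne by auto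
    let ?U = "U - {u}"
    have c: "card U = Suc (card ?U)" by (rule card.remove[OF less.prems(1) u(1)])
    obtain W where W: "W \<subseteq> ?U" "card W = s" "real s * sum f ?U \<le> real (card ?U) * sum f W"
      using less.hyps[of ?U] less.prems(1) lt c by auto
    have su: "sum f U = f u + sum f ?U" using u(1) less.prems(1) by (simp add: sum.remove)
    have "real s * f u \<le> sum f W"
      using sum_bounded_below[of W "f u" f] u W by auto
    then have "real s * sum f U \<le> real (card U) * sum f W"
      using W(3) c su by (simp add: algebra_simps)
    then show ?thesis using W by blast
  qed
qed

lemma perfect_on_has_perfect_matching:
  assumes "perfect_on V E m"
  shows "has_perfect_matching (V, E)"
proof -
  have m: "m (m v) = v" "v \<in> V \<Longrightarrow> {v, m v} \<in> E" for v
    using assms by (auto simp: perfect_on_def matching_on_def)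
  have "\<exists>!e. e \<in> (\<lambda>v. {v, m v}) ` V \<and> v \<in> e" if "v \<in> V" for v
  proof (rule ex1I[of _ "{v, m v}"])
    show "e = {v, m v}" if h: "e \<in> (\<lambda>v. {v, m v}) ` V \<and> v \<in> e" for e
    proof -
      obtain u where "e = {u, m u}" "v = u \<or> v = m u" using h by auto
      then show ?thesis using m(1) by auto
    qed
  qed (use that in auto)
  then show ?thesis unfolding has_perfect_matching_def
    using m(2) by (intro exI[of _ "(\<lambda>v. {v, m v}) ` V"]) auto
qed

section \<open>Lower bound on the resilience\<close>

text \<open>If \<open>r < d/2 - 2 l\<close>, then
  \<open>d - r > (d (n - s) / 2n + l) + (d s / 2n + l)\<close>. The first bracket bounds the average
  degree inside the small classes of the barrier, the second is what pseudorandomness allows from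
  \<open>s\<close> vertices into \<open>S\<close> on average.\<close>

lemma resilience_lower:
  fixes E :: "'a set set"
  assumes fin: "finite V" and cV: "card V = 2 * n" "n \<ge> 1" and E: "edges_on V E"
    and reg: "\<And>v. v \<in> V \<Longrightarrow> nbrs E V v = d"
    and pr: "pseudorandom V d l E" and l: "l \<ge> 0"
    and H: "spanning_subgraph H (V, E)" and no: "\<not> has_perfect_matching (delete_edges (V, E) H)"
  shows "real d / 2 - 2 * l \<le> real (max_degree H)"
proof (rule ccontr)
  assume small: "\<not> ?thesis"
  define F where "F = E - edges H"
  define r where "r = max_degree H"
  have HE: "verts H = V" "edges H \<subseteq> E" using H by (auto simp: spanning_subgraph_def)
  have F: "edges_on V F" using E by (auto simp: F_def edges_on_def)
  have EV: "finite E" using E fin by (auto simp: edges_on_def intro: finite_subset[of _ "Pow V"])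
  have degF: "d \<le> nbrs F V v + r" if v: "v \<in> V" for v
  proof -
    have "{e \<in> E. v \<in> e} = {e \<in> F. v \<in> e} \<union> {e \<in> edges H. v \<in> e}"
      using HE by (auto simp: F_def)
    then have "card {e \<in> E. v \<in> e} \<le> card {e \<in> F. v \<in> e} + card {e \<in> edges H. v \<in> e}"
      by (simp add: card_Un_le)
    moreover have "card {e \<in> edges H. v \<in> e} \<le> r"
      unfolding r_def max_degree_def using fin v HE
      by (intro Max_ge) (auto simp: vertex_degree_def)
    ultimately show ?thesis using reg[OF v] card_incident_edges[OF E] card_incident_edges[OF F] by simp
  qed
  have "\<nexists>m. perfect_on V F m"
    using perfect_on_has_perfect_matching no by (fastforce simp: delete_edges_def F_def)
  moreover have "even (card V)" using cV by simp
  ultimately obtain S :: "'a set" and c :: "'a \<Rightarrow> 'a set" where S: "S \<subseteq> V"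
    and c: "\<And>u v. u \<in> V - S \<Longrightarrow> v \<in> V - S \<Longrightarrow> {u, v} \<in> F \<Longrightarrow> c u = c v"
    and big: "card S + 2 \<le> card (c ` (V - S))"
    using no_perfect_matching_barrier[of V F] fin F unfolding edges_on_def by blast
  define R where "R = V - S"
  define s where "s = card S"
  define Q where "Q = c ` R"
  define C where "C q = {v \<in> R. c v = q}" for q
  have finR: "finite R" and finQ: "finite Q" and finS: "finite S" and finC: "finite (C q)" for q
    using fin S by (auto simp: R_def Q_def C_def intro: finite_subset)
  have CV: "C q \<subseteq> V" for q by (auto simp: C_def R_def)
  have sumC: "card (\<Union>q\<in>P. C q) = (\<Sum>q\<in>P. card (C q))" if "P \<subseteq> Q" for P
    using that finQ finC by (intro card_UN_disjoint) (auto simp: C_def intro: finite_subset)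
  have pos: "1 \<le> card (C q)" if "q \<in> Q" for q
    using that finC[of q] by (auto simp: C_def Q_def Suc_le_eq card_gt_0_iff)
  have "(\<Union>q\<in>Q. C q) = R" by (auto simp: Q_def C_def)
  then have tot: "(\<Sum>q\<in>Q. card (C q)) = 2 * n - s" and sn: "s \<le> 2 * n"
    using sumC[of Q] cV card_Diff_subset[OF finS S] card_mono[OF fin S] by (auto simp: R_def s_def)
  have cQ: "s + 2 \<le> card Q" using big by (simp add: Q_def R_def s_def)
  then have "Q \<noteq> {}" by auto
  then obtain q0 where q0: "q0 \<in> Q" "\<And>q. q \<in> Q \<Longrightarrow> card (C q) \<le> card (C q0)"
    using finite_arg_max[of Q "\<lambda>q. card (C q)"] finQ by blast
  \<comment> \<open>Besides \<open>q\<close> and the largest class \<open>q0\<close> there are at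
    least \<open>s\<close> nonempty classes, so \<open>2 * card (C q) + s\<close> is at most the
    total \<open>2 * n - s\<close>.\<close>
  have Csmall: "card (C q) + s \<le> n" if q: "q \<in> Q - {q0}" for q
  proof -
    have "Q = insert q (insert q0 (Q - {q, q0}))" using q q0 by auto
    then have "(\<Sum>q\<in>Q. card (C q)) = card (C q) + (card (C q0) + (\<Sum>q\<in>Q - {q, q0}. card (C q)))"
      using q finQ by (metis (no_types, lifting) Diff_iff finite.insertI finite_Diff insertCI insertE
          insert_iff sum.insert)
    moreover have "card (Q - {q, q0}) \<le> (\<Sum>q\<in>Q - {q, q0}. card (C q))"
      using sum_mono[of "Q - {q, q0}" "\<lambda>_. 1" "\<lambda>q. card (C q)"] pos by simp
    moreover have "card (Q - {q, q0}) = card Q - 2"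
      using q q0 finQ by (subst card_Diff_subset) auto
    moreover have "card (C q) \<le> card (C q0)" using q0(2) q by simp
    ultimately show ?thesis using tot cQ sn by linarith
  qed
  have "card (Q - {q0}) \<noteq> 0" using cQ q0 finQ by simp
  then obtain q1 where q1: "q1 \<in> Q - {q0}" by (metis card.empty ex_in_conv)
  have sn1: "s + 1 \<le> n" using Csmall[OF q1] pos[of q1] q1 by simp
  define U where "U = (\<Union>q\<in>Q - {q0}. C q)"
  have finU: "finite U" using finQ finC by (simp add: U_def)
  have UR: "U \<subseteq> R" by (auto simp: U_def C_def)
  have cU: "card U = (\<Sum>q\<in>Q - {q0}. card (C q))" unfolding U_def by (rule sumC) auto
  have "card (Q - {q0}) \<le> card U"
    unfolding cU using sum_mono[of "Q - {q0}" "\<lambda>_. 1" "\<lambda>q. card (C q)"] pos by simp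
  then have Us: "s + 1 \<le> card U" using cQ q0 finQ by simp
  have sumU: "(\<Sum>u\<in>U. f u) = (\<Sum>q\<in>Q - {q0}. \<Sum>u\<in>C q. f u)" for f :: "'a \<Rightarrow> real"
    unfolding U_def using finQ finC by (intro sum.UNION_disjoint) (auto simp: C_def)
  let ?b = "real d * real (n - s) / real (2 * n) + l"
  have inner: "(\<Sum>u\<in>C q. real (nbrs E (C q) u)) \<le> real (card (C q)) * ?b" if q: "q \<in> Q - {q0}" for q
  proof -
    have "real (card (edge_pairs E (C q) (C q)))
        \<le> real d * real (card (C q)) ^ 2 / real (card V) + l * real (card (C q))"
      using Csmall[OF q] pos[of q] q cV by (intro pseudorandomD[OF pr CV CV]) auto
    also have "\<dots> = real (card (C q)) * (real d * real (card (C q)) / real (2 * n) + l)"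
      using cV by (simp add: algebra_simps power2_eq_square)
    also have "\<dots> \<le> real (card (C q)) * ?b"
      using Csmall[OF q] by (intro mult_left_mono add_right_mono divide_right_mono) auto
    finally show ?thesis using card_edge_pairs[OF finC finC, of E q q] by simp
  qed
  have one: "real d - real r \<le> real (nbrs E (C q) u) + real (nbrs E S u)"
    if q: "q \<in> Q - {q0}" and u: "u \<in> C q" for q u
  proof -
    have uR: "u \<in> V - S" "c u = q" using u by (auto simp: C_def R_def)
    have "{b \<in> V. {u, b} \<in> F} \<subseteq> {b \<in> C q. {u, b} \<in> E} \<union> {b \<in> S. {u, b} \<in> E}"
    proof
      fix b assume "b \<in> {b \<in> V. {u, b} \<in> F}"
      then show "b \<in> {b \<in> C q. {u, b} \<in> E} \<union> {b \<in> S. {u, b} \<in> E}"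
        using c[of u b] uR by (auto simp: C_def R_def F_def)
    qed
    then have "nbrs F V u \<le> card ({b \<in> C q. {u, b} \<in> E} \<union> {b \<in> S. {u, b} \<in> E})"
      using finC finS by (intro card_mono) auto
    also have "\<dots> \<le> nbrs E (C q) u + nbrs E S u" by (rule card_Un_le)
    finally show ?thesis using degF[of u] uR by (simp add: algebra_simps flip: of_nat_add)
  qed
  have "real (card U) * (real d - real r) = (\<Sum>u\<in>U. real d - real r)" by simp
  also have "\<dots> \<le> (\<Sum>q\<in>Q - {q0}. \<Sum>u\<in>C q. real (nbrs E (C q) u) + real (nbrs E S u))"
    unfolding sumU using one by (intro sum_mono) auto
  also have "\<dots> = (\<Sum>q\<in>Q - {q0}. \<Sum>u\<in>C q. real (nbrs E (C q) u)) + (\<Sum>u\<in>U. real (nbrs E S u))"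
    unfolding sumU by (simp add: sum.distrib)
  also have "(\<Sum>q\<in>Q - {q0}. \<Sum>u\<in>C q. real (nbrs E (C q) u)) \<le> (\<Sum>q\<in>Q - {q0}. real (card (C q)) * ?b)"
    using inner by (intro sum_mono) auto
  also have "\<dots> = real (card U) * ?b" unfolding cU by (simp add: sum_distrib_right)
  finally have tot2: "real (card U) * (real d - real r) \<le> real (card U) * ?b + (\<Sum>u\<in>U. real (nbrs E S u))"
    by simp
  have "?b = real d / 2 - real d * real s / real (2 * n) + l"
    using sn1 cV by (simp add: field_simps of_nat_diff)
  then have "real d - real r > ?b + (l + real d * real s / real (2 * n))"
    using small by (simp add: r_def)
  then have "real (card U) * (real d - real r) > real (card U) * (?b + (l + real d * real s / real (2 * n)))"
    using Us by (intro mult_strict_left_mono) auto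
  then have key: "(\<Sum>u\<in>U. real (nbrs E S u)) > real (card U) * (l + real d * real s / real (2 * n))"
    using tot2 by (simp only: distrib_left)
  \<comment> \<open>Pseudorandomness speaks of nonempty sets only, so an empty \<open>S\<close> is
    treated separately.\<close>
  show False
  proof (cases "s = 0")
    case True
    then have "S = {}" using finS by (simp add: s_def)
    then have "(\<Sum>u\<in>U. real (nbrs E S u)) = 0" by simp
    then show False using key l True by (simp add: mult_less_0_iff)
  next
    case False
    \<comment> \<open>\<open>U\<close> is larger than \<open>S\<close>; averaging passes to
      \<open>s\<close> of its vertices, as the edge bound needs sets of equal size.\<close>
    obtain W where W: "W \<subseteq> U" "card W = s"
      "real s * (\<Sum>u\<in>U. real (nbrs E S u)) \<le> real (card U) * (\<Sum>u\<in>W. real (nbrs E S u))"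
      using subset_with_large_average[OF finU, of s "\<lambda>u. real (nbrs E S u)"] Us by auto
    have finW: "finite W" using W(1) finU by (rule finite_subset)
    have "real (card (edge_pairs E W S)) \<le> real d * real (card S) ^ 2 / real (card V) + l * real (card S)"
      using W UR S False sn1 cV by (intro pseudorandomD[OF pr]) (auto simp: R_def s_def)
    then have "(\<Sum>u\<in>W. real (nbrs E S u)) \<le> real s * (l + real d * real s / real (2 * n))"
      using card_edge_pairs[OF finW finS, of E] cV by (simp add: s_def algebra_simps power2_eq_square)
    then have "real (card U) * (\<Sum>u\<in>W. real (nbrs E S u))
        \<le> real (card U) * (real s * (l + real d * real s / real (2 * n)))"
      by (intro mult_left_mono) auto
    also have "\<dots> = real s * (real (card U) * (l + real d * real s / real (2 * n)))" by simp
    also have "\<dots> < real s * (\<Sum>u\<in>U. real (nbrs E S u))"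
      using key False by (intro mult_strict_left_mono) auto
    finally show False using W(3) by simp
  qed
qed

section \<open>Upper bound on the resilience\<close>

text \<open>\<open>A\<close> is the larger side of a maximum cut. Moving \<open>a\<close> to the
  other side changes the cut by \<open>nbrs E A a - nbrs E (V - A) a\<close>, which maximality makes
  nonpositive.\<close>

lemma max_cut_exists:
  assumes fin: "finite V" and E: "edges_on V E"
  obtains A where "A \<subseteq> V" "card V \<le> 2 * card A" "\<And>a. a \<in> A \<Longrightarrow> 2 * nbrs E A a \<le> nbrs E V a"
proof -
  let ?cut = "\<lambda>A. card (edge_pairs E A (V - A))"
  obtain A0 where A0: "A0 \<in> Pow V" "\<And>B. B \<in> Pow V \<Longrightarrow> ?cut B \<le> ?cut A0"
    using finite_arg_max[of "Pow V" ?cut] fin by blast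
  have "?cut (V - A0) = ?cut A0"
    using A0(1) card_edge_pairs_swap[of E A0] by (simp add: double_diff)
  moreover have "card V \<le> 2 * card A0 \<or> card V \<le> 2 * card (V - A0)"
    using A0(1) fin card_Diff_subset[of A0 V] card_mono[of V A0] finite_subset[of A0 V] by fastforce
  ultimately obtain A where A: "A \<subseteq> V" "card V \<le> 2 * card A" "\<And>B. B \<subseteq> V \<Longrightarrow> ?cut B \<le> ?cut A"
    using A0 by (metis Diff_subset Pow_iff)
  have finA: "finite A" using A(1) fin by (rule finite_subset)
  have "2 * nbrs E A a \<le> nbrs E V a" if a: "a \<in> A" for a
  proof -
    let ?B = "A - {a}"
    have VB: "V - ?B = (V - A) \<union> {a}" using a A(1) by auto
    have "?cut ?B = (\<Sum>x\<in>?B. nbrs E ((V - A) \<union> {a}) x)"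
      unfolding VB using fin finA by (intro card_edge_pairs) auto
    also have "\<dots> = (\<Sum>x\<in>?B. nbrs E (V - A) x + nbrs E {a} x)"
      using fin a by (intro sum.cong refl nbrs_disjoint_Un) auto
    also have "\<dots> = (\<Sum>x\<in>?B. nbrs E (V - A) x) + card (edge_pairs E ?B {a})"
      using finA by (simp add: sum.distrib card_edge_pairs)
    also have "card (edge_pairs E ?B {a}) = nbrs E ?B a"
      using finA by (subst card_edge_pairs_swap, subst card_edge_pairs) auto
    also have "{b \<in> ?B. {a, b} \<in> E} = {b \<in> A. {a, b} \<in> E}"
      using edges_on_pair[OF E] by auto
    finally have 1: "?cut ?B = (\<Sum>x\<in>?B. nbrs E (V - A) x) + nbrs E A a" .
    have 2: "?cut A = (\<Sum>x\<in>?B. nbrs E (V - A) x) + nbrs E (V - A) a"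
      using card_edge_pairs[of A "V - A" E] fin finA a by (simp add: sum.remove)
    have "?cut ?B \<le> ?cut A" using A by blast
    then have "nbrs E A a \<le> nbrs E (V - A) a" using 1 2 by simp
    moreover have "nbrs E (A \<union> (V - A)) a = nbrs E A a + nbrs E (V - A) a"
      using fin finA by (intro nbrs_disjoint_Un) auto
    moreover have "A \<union> (V - A) = V" using A(1) by auto
    ultimately show ?thesis by (simp only:)
  qed
  then show ?thesis using that A by blast
qed

text \<open>Deleting all edges inside \<open>A\<close> makes \<open>A\<close> independent, so a
  perfect matching would inject \<open>A\<close> into the smaller set \<open>V - A\<close>.\<close>

lemma local_resilience_le:
  assumes fin: "finite V" and E: "edges_on V E" and A: "A \<subseteq> V" "card V < 2 * card A"
    and deg: "\<And>a. a \<in> A \<Longrightarrow> nbrs E A a \<le> k"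
  shows "local_resilience (V, E) has_perfect_matching \<le> k"
proof -
  define H where "H = (V, {e \<in> E. e \<subseteq> A})"
  have finA: "finite A" using A(1) fin by (rule finite_subset)
  have "V \<noteq> {}" using A by auto
  have HA: "edges_on V {e \<in> E. e \<subseteq> A}" using E by (auto simp: edges_on_def)
  have "vertex_degree H v \<le> k" for v
  proof (cases "v \<in> A")
    case True
    have "{b \<in> V. {v, b} \<in> {e \<in> E. e \<subseteq> A}} = {b \<in> A. {v, b} \<in> E}" using True A by auto
    then show ?thesis using deg[OF True] card_incident_edges[OF HA, of v]
      by (simp add: vertex_degree_def H_def)
  next
    case False
    then have "{e \<in> edges H. v \<in> e} = {}" by (auto simp: H_def)
    then show ?thesis by (simp add: vertex_degree_def del: Collect_empty_eq)
  qed
  then have k: "max_degree H \<le> k"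
    unfolding max_degree_def using fin \<open>V \<noteq> {}\<close> by (subst Max_le_iff) (auto simp: H_def)
  have "\<not> has_perfect_matching (delete_edges (V, E) H)"
  proof
    assume "has_perfect_matching (delete_edges (V, E) H)"
    then obtain M where M: "M \<subseteq> E - edges H" "\<And>v. v \<in> V \<Longrightarrow> \<exists>!e. e \<in> M \<and> v \<in> e"
      by (auto simp: has_perfect_matching_def delete_edges_def)
    have ex: "\<exists>w. {v, w} \<in> M \<and> w \<in> V - A" if v: "v \<in> A" for v
    proof -
      have "v \<in> V" using v A(1) by blast
      then obtain e where e: "e \<in> M" "v \<in> e" using M(2)[of v] by blast
      then have eE: "e \<in> E" "\<not> e \<subseteq> A" using M(1) by (auto simp: H_def)
      then have "card e = 2" "e \<subseteq> V" using E by (auto simp: edges_on_def)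
      then obtain w where "e = {v, w}" using e by (auto simp: card_2_iff)
      then show ?thesis using e eE v \<open>e \<subseteq> V\<close> by auto
    qed
    then obtain w where w: "\<And>v. v \<in> A \<Longrightarrow> {v, w v} \<in> M \<and> w v \<in> V - A" by metis
    have "inj_on w A"
    proof (rule inj_onI)
      fix u v assume "u \<in> A" "v \<in> A" "w u = w v"
      then have "{u, w u} = {v, w u}" using w M(2)[of "w u"] by (metis Diff_iff insertCI)
      then show "u = v" by (auto simp: doubleton_eq_iff)
    qed
    then have "card A \<le> card (V - A)"
      using w fin by (intro card_inj_on_le[of w]) auto
    then show False using A card_Diff_subset[OF finA A(1)] by linarith
  qed
  then have "local_resilience (V, E) has_perfect_matching \<le> max_degree H"
    unfolding local_resilience_def by (intro Least_le exI[of _ H]) (auto simp: spanning_subgraph_def H_def)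
  then show ?thesis using k by simp
qed

lemma resilience_upper:
  assumes fin: "finite V" and cV: "card V = 2 * n" "n \<ge> 1" and E: "edges_on V E"
    and reg: "\<And>v. v \<in> V \<Longrightarrow> nbrs E V v = d"
    and pr: "pseudorandom V d l E" and l: "l \<ge> 0"
  shows "real (local_resilience (V, E) has_perfect_matching) \<le> real d / 2 + l + 1"
proof -
  obtain A where A: "A \<subseteq> V" "card V \<le> 2 * card A" "\<And>a. a \<in> A \<Longrightarrow> 2 * nbrs E A a \<le> nbrs E V a"
    using max_cut_exists[OF fin E] by blast
  have finA: "finite A" using A(1) fin by (rule finite_subset)
  \<comment> \<open>Degrees are integers, so the real bound may be rounded down to fit
    \<open>local_resilience_le\<close>.\<close>
  define k where "k = nat \<lfloor>real d / 2 + l + 1\<rfloor>"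
  have k: "j \<le> k" if "real j \<le> real d / 2 + l + 1" for j
    using that unfolding k_def by (rule le_nat_floor)
  have degA: "real (nbrs E A a) \<le> real d / 2" if "a \<in> A" for a
    using A(3)[OF that] reg[of a] that A(1) by (auto simp: field_simps)
  have "\<exists>B. B \<subseteq> V \<and> card V < 2 * card B \<and> (\<forall>b\<in>B. real (nbrs E B b) \<le> real d / 2 + l + 1)"
  proof (cases "card V < 2 * card A")
    case True
    moreover have "real (nbrs E A a) \<le> real d / 2 + l + 1" if "a \<in> A" for a
      using degA[OF that] l by linarith
    ultimately show ?thesis using A(1) by blast
  next
    case False
    then have cA: "card A = n" and cB: "card (V - A) = n"
      using A cV card_Diff_subset[OF finA A(1)] by auto
    have "real (card (edge_pairs E (V - A) A)) \<le> real d * real (card A) ^ 2 / real (card V) + l * real (card A)"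
      using A(1) cA cB cV by (intro pseudorandomD[OF pr]) auto
    also have "\<dots> = real n * (real d / 2 + l)" using cA cV by (simp add: field_simps power2_eq_square)
    finally have cut: "(\<Sum>v\<in>V - A. real (nbrs E A v)) \<le> real n * (real d / 2 + l)"
      using card_edge_pairs[of "V - A" A E] fin finA by simp
    have "V - A \<noteq> {}" using cB cV(2) by (metis card.empty not_one_le_zero)
    have "\<exists>v\<in>V - A. real (nbrs E A v) \<le> real d / 2 + l"
    proof (rule ccontr)
      assume "\<not> ?thesis"
      then have "(\<Sum>v\<in>V - A. real d / 2 + l) < (\<Sum>v\<in>V - A. real (nbrs E A v))"
        using fin \<open>V - A \<noteq> {}\<close> by (intro sum_strict_mono) (auto simp: not_le)
      then show False using cut cB by simp
    qed
    then obtain v where v: "v \<in> V - A" "real (nbrs E A v) \<le> real d / 2 + l" by blast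
    \<comment> \<open>Adding \<open>v\<close> gives each vertex at most one more neighbour, whence
      the \<open>+ 1\<close>.\<close>
    have "real (nbrs E (A \<union> {v}) b) \<le> real d / 2 + l + 1" if b: "b \<in> A \<union> {v}" for b
    proof -
      have "nbrs E (A \<union> {v}) b = nbrs E A b + nbrs E {v} b"
        using finA v by (intro nbrs_disjoint_Un) auto
      moreover have "nbrs E {v} b \<le> card {v}" by (intro card_mono) auto
      ultimately show ?thesis using b v degA[of b] l by auto
    qed
    moreover have "card (A \<union> {v}) = n + 1" using v finA cA by simp
    ultimately show ?thesis using A(1) v cV by (intro exI[of _ "A \<union> {v}"]) auto
  qed
  then obtain B where "B \<subseteq> V" "card V < 2 * card B" "\<forall>b\<in>B. real (nbrs E B b) \<le> real d / 2 + l + 1"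
    by blast
  then have "local_resilience (V, E) has_perfect_matching \<le> k"
    using k by (intro local_resilience_le[OF fin E]) auto
  moreover have "real k \<le> real d / 2 + l + 1" using l by (simp add: k_def)
  ultimately show ?thesis by linarith
qed

section \<open>Switchings\<close>

definition regular_edges :: "'a set \<Rightarrow> nat \<Rightarrow> 'a set set set" where
  "regular_edges V d = {E. edges_on V E \<and> (\<forall>v\<in>V. nbrs E V v = d)}"

definition switch :: "'a set set \<Rightarrow> 'a \<Rightarrow> 'a \<Rightarrow> 'a \<Rightarrow> 'a \<Rightarrow> 'a set set" where
  "switch E u v x y = (E - {{u, v}, {x, y}}) \<union> {{u, x}, {v, y}}"

lemma finite_regular_edges: "finite V \<Longrightarrow> finite (regular_edges V d)"
  by (rule finite_subset[of _ "Pow (Pow V)"]) (auto simp: regular_edges_def edges_on_def)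

lemma card_replace: "finite I \<Longrightarrow> a \<in> I \<Longrightarrow> b \<notin> I \<Longrightarrow> card (insert b (I - {a})) = card I"
  by (metis DiffD1 card.remove card_insert_disjoint finite_Diff)

text \<open>Each of the four vertices lies in exactly one removed and one added edge, any other
  vertex in none.\<close>

lemma switch_regular:
  assumes fin: "finite V" and E: "E \<in> regular_edges V d" and e: "{u, v} \<in> E" "{x, y} \<in> E"
    and ne: "u \<noteq> x" "v \<noteq> y" "u \<noteq> y" "v \<noteq> x" and n: "{u, x} \<notin> E" "{v, y} \<notin> E"
  shows "switch E u v x y \<in> regular_edges V d"
proof -
  have E2: "edges_on V E" using E by (simp add: regular_edges_def)
  have V: "u \<in> V" "v \<in> V" "x \<in> V" "y \<in> V" "u \<noteq> v" "x \<noteq> y" using edges_on_pair[OF E2] e by blast+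
  let ?E = "switch E u v x y"
  have E2': "edges_on V ?E" using E2 V ne by (auto simp: edges_on_def switch_def)
  have "card {e \<in> ?E. w \<in> e} = card {e \<in> E. w \<in> e}" for w
  proof -
    have "finite E" using E2 fin by (auto simp: edges_on_def intro: finite_subset[of _ "Pow V"])
    then have finI: "finite {e \<in> E. w \<in> e}" by simp
    have I: "{e \<in> ?E. w \<in> e} = {e \<in> E. w \<in> e}" if "w \<notin> {u, v, x, y}"
      using that by (auto simp: switch_def)
    \<comment> \<open>\<open>a\<close> and \<open>b\<close> are the removed and the added edge at
      \<open>w\<close>; \<open>a'\<close> and \<open>b'\<close> are those that miss
      \<open>w\<close>.\<close>
    have R: "{e \<in> ?E. w \<in> e} = insert b ({e \<in> E. w \<in> e} - {a})"
      if "{{u, v}, {x, y}} = {a, a'}" "{{u, x}, {v, y}} = {b, b'}" "w \<in> b" "w \<notin> a'" "w \<notin> b'"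
      for a a' b b'
      using that(3-5) unfolding switch_def that(1,2) by blast
    consider "w \<notin> {u, v, x, y}" | "w = u" | "w = v" | "w = x" | "w = y" by blast
    then show ?thesis
    proof cases
      case 1
      then show ?thesis using I by simp
    next
      case 2
      then show ?thesis
        using R[of "{u, v}" "{x, y}" "{u, x}" "{v, y}"] card_replace[OF finI, of "{u, v}" "{u, x}"] e n V ne
        by (simp add: insert_commute)
    next
      case 3
      then show ?thesis
        using R[of "{u, v}" "{x, y}" "{v, y}" "{u, x}"] card_replace[OF finI, of "{u, v}" "{v, y}"] e n V ne
        by (simp add: insert_commute)
    next
      case 4
      then show ?thesis
        using R[of "{x, y}" "{u, v}" "{u, x}" "{v, y}"] card_replace[OF finI, of "{x, y}" "{u, x}"] e n V ne
        by (simp add: insert_commute)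
    next
      case 5
      then show ?thesis
        using R[of "{x, y}" "{u, v}" "{v, y}" "{u, x}"] card_replace[OF finI, of "{x, y}" "{v, y}"] e n V ne
        by (simp add: insert_commute)
    qed
  qed
  then have "nbrs ?E V w = nbrs E V w" for w
    using card_incident_edges[OF E2] card_incident_edges[OF E2'] by metis
  then show ?thesis using E E2' by (simp add: regular_edges_def)
qed

text \<open>Makes switching injective: the new edge set and the four vertices determine the old
  one.\<close>

lemma switch_undo:
  assumes "{u, v} \<in> E" "{x, y} \<in> E" "{u, x} \<notin> E" "{v, y} \<notin> E"
  shows "(switch E u v x y - {{u, x}, {v, y}}) \<union> {{u, v}, {x, y}} = E"
  using assms unfolding switch_def by blast

lemma switch_edge_pairs:
  assumes "U = S \<or> U \<inter> S = {}" "x \<notin> S" "y \<notin> U" "u \<in> U" "v \<in> S" "finite U" "finite S"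
  shows "card (edge_pairs E U S) \<le> card (edge_pairs (switch E u v x y) U S) + 2"
proof -
  \<comment> \<open>The pairs that can be lost. If \<open>U = S\<close>, the edge \<open>xy\<close>
    has no end in \<open>S\<close>; if the sets are disjoint, \<open>uv\<close> counts in one
    orientation only, and so does \<open>xy\<close>, because \<open>y\<close> is not in
    \<open>U\<close>.\<close>
  define D where "D = (if U = S then {(u, v), (v, u)} else {(u, v), (x, y)})"
  have "edge_pairs E U S \<subseteq> edge_pairs (switch E u v x y) U S \<union> D"
  proof
    fix p assume p: "p \<in> edge_pairs E U S"
    obtain a b where ab: "p = (a, b)" by (cases p)
    have in': "a \<in> U" "b \<in> S" "{a, b} \<in> E" using p ab by (auto simp: edge_pairs_def)
    show "p \<in> edge_pairs (switch E u v x y) U S \<union> D"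
    proof (cases "{a, b} = {u, v} \<or> {a, b} = {x, y}")
      case True
      then have "a = u \<and> b = v \<or> a = v \<and> b = u \<or> a = x \<and> b = y \<or> a = y \<and> b = x"
        by (auto simp: doubleton_eq_iff)
      then have "p \<in> D" using in' assms ab unfolding D_def by auto
      then show ?thesis by blast
    next
      case False
      then show ?thesis using in' ab by (auto simp: edge_pairs_def switch_def)
    qed
  qed
  moreover have "finite (edge_pairs (switch E u v x y) U S \<union> D)"
    using assms(6,7) by (simp add: finite_edge_pairs D_def)
  ultimately have "card (edge_pairs E U S) \<le> card (edge_pairs (switch E u v x y) U S \<union> D)"
    by (rule card_mono[rotated])
  also have "\<dots> \<le> card (edge_pairs (switch E u v x y) U S) + card D" by (rule card_Un_le)
  finally have "card (edge_pairs E U S) \<le> card (edge_pairs (switch E u v x y) U S) + card D" .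
  moreover have "card D \<le> 2"
    unfolding D_def using card_length[of "[(u, v), (v, u)]"] card_length[of "[(u, v), (x, y)]"] by (cases "U = S") auto
  ultimately show ?thesis by linarith
qed

context
  fixes V :: "'a set" and d :: nat and E :: "'a set set"
  assumes fin: "finite V" and E: "E \<in> regular_edges V d"
begin

lemma card_edge_pairs_regular:
  assumes "A \<subseteq> V"
  shows "card (edge_pairs E A V) = d * card A"
proof -
  have "card (edge_pairs E A V) = (\<Sum>a\<in>A. nbrs E V a)"
    using fin finite_subset[OF assms fin] by (rule card_edge_pairs[rotated])
  also have "\<dots> = (\<Sum>a\<in>A. d)"
    using E assms by (intro sum.cong) (auto simp: regular_edges_def)
  finally show ?thesis by simp
qed

lemma card_edge_pairs_Diff:
  assumes "A \<subseteq> V" "B \<subseteq> V"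
  shows "card (edge_pairs E A (V - B)) = d * card A - card (edge_pairs E A B)"
    "card (edge_pairs E A B) \<le> d * card A"
proof -
  have "finite A" "finite B" using assms fin by (auto intro: finite_subset)
  moreover have "edge_pairs E A V = edge_pairs E A B \<union> edge_pairs E A (V - B)"
    using assms by (auto simp: edge_pairs_def)
  moreover have "edge_pairs E A B \<inter> edge_pairs E A (V - B) = {}" by (auto simp: edge_pairs_def)
  ultimately have "d * card A = card (edge_pairs E A B) + card (edge_pairs E A (V - B))"
    using card_edge_pairs_regular[OF assms(1)] fin
    by (metis card_Un_disjoint finite_Diff finite_edge_pairs)
  then show "card (edge_pairs E A (V - B)) = d * card A - card (edge_pairs E A B)"
    "card (edge_pairs E A B) \<le> d * card A" by auto
qed

text \<open>The pair is ordered since \<open>x\<close> is to be joined to \<open>u\<close> and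
  \<open>y\<close> to \<open>v\<close>. For \<open>u\<close> in \<open>U\<close> and
  \<open>v\<close> in \<open>S\<close>, the conditions \<open>u \<noteq> y\<close> and
  \<open>v \<noteq> x\<close> come for free.\<close>

definition switch_partners :: "'a set \<Rightarrow> 'a set \<Rightarrow> 'a \<times> 'a \<Rightarrow> ('a \<times> 'a) set" where
  "switch_partners U S = (\<lambda>(u, v). {(x, y). (x, y) \<in> edge_pairs E (V - S) (V - U) \<and>
     u \<noteq> x \<and> v \<noteq> y \<and> {u, x} \<notin> E \<and> {v, y} \<notin> E})"

text \<open>Inclusion-exclusion: from all \<open>card V * d\<close> ordered edges, remove those
  starting in \<open>S\<close> or ending in \<open>U\<close>, where the edges doing both are counted
  by \<open>edge_pairs E U S\<close>. Of the rest, at most \<open>d * (d + 1)\<close> start in the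
  closed neighbourhood of \<open>u\<close>, and as many end in that of \<open>v\<close>. The
  additive form avoids truncated subtraction.\<close>

lemma card_switch_partners:
  assumes "U \<subseteq> V" "S \<subseteq> V" "u \<in> V" "v \<in> V"
  shows "card V * d + card (edge_pairs E U S)
    \<le> card (switch_partners U S (u, v)) + d * card U + d * card S + 2 * (d * (d + 1))"
proof -
  have finUS: "finite U" "finite S" using assms fin by (auto intro: finite_subset)
  have deg: "nbrs E V w = d" if "w \<in> V" for w using E that by (simp add: regular_edges_def)
  let ?O = "edge_pairs E (V - S) (V - U)"
  let ?N = "\<lambda>w. insert w {b \<in> V. {w, b} \<in> E}"
  have VV: "edge_pairs E V V = ?O \<union> (edge_pairs E S V \<union> edge_pairs E V U)"
    using assms by (auto simp: edge_pairs_def)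
  have "card V * d = card (edge_pairs E V V)" using card_edge_pairs_regular[of V] by simp
  also have "\<dots> \<le> card ?O + card (edge_pairs E S V \<union> edge_pairs E V U)"
    unfolding VV by (rule card_Un_le)
  finally have 1: "card V * d \<le> card ?O + card (edge_pairs E S V \<union> edge_pairs E V U)" .
  have "card (edge_pairs E S V) + card (edge_pairs E V U)
      = card (edge_pairs E S V \<union> edge_pairs E V U) + card (edge_pairs E S V \<inter> edge_pairs E V U)"
    using fin finUS by (intro card_Un_Int finite_edge_pairs)
  moreover have "edge_pairs E S V \<inter> edge_pairs E V U = edge_pairs E S U"
    using assms by (auto simp: edge_pairs_def)
  moreover have "card (edge_pairs E V U) = d * card U"
    using card_edge_pairs_swap[of E V U] card_edge_pairs_regular[OF assms(1)] by simp
  ultimately have 2: "d * card S + d * card U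
      = card (edge_pairs E S V \<union> edge_pairs E V U) + card (edge_pairs E U S)"
    using card_edge_pairs_regular[OF assms(2)] card_edge_pairs_swap[of E S U] by simp
  have N: "?N w \<subseteq> V" "card (?N w) \<le> d + 1" if "w \<in> V" for w
    using that deg[OF that] fin by (auto simp: card_insert_if)
  have bad: "card (edge_pairs E (?N w) V) \<le> d * (d + 1)" if "w \<in> V" for w
    unfolding card_edge_pairs_regular[OF N(1)[OF that]] using N(2)[OF that] by (rule mult_left_mono) simp
  have "?O \<subseteq> switch_partners U S (u, v) \<union> (edge_pairs E (?N u) V \<union> edge_pairs E V (?N v))"
    by (auto simp: switch_partners_def edge_pairs_def)
  then have "card ?O \<le> card (switch_partners U S (u, v) \<union> (edge_pairs E (?N u) V \<union> edge_pairs E V (?N v)))"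
    by (rule card_mono[rotated])
      (use fin in \<open>auto simp: switch_partners_def finite_edge_pairs intro: finite_subset[of _ ?O]\<close>)
  also have "\<dots> \<le> card (switch_partners U S (u, v)) + (card (edge_pairs E (?N u) V) + card (edge_pairs E V (?N v)))"
    by (meson add_left_mono card_Un_le le_trans)
  also have "\<dots> \<le> card (switch_partners U S (u, v)) + (d * (d + 1) + d * (d + 1))"
    using bad[OF assms(3)] bad[OF assms(4)] card_edge_pairs_swap[of E V "?N v"] by simp
  finally show ?thesis using 1 2 by linarith
qed

end

definition heavy :: "'a set \<Rightarrow> nat \<Rightarrow> 'a set \<Rightarrow> 'a set \<Rightarrow> nat \<Rightarrow> 'a set set set" where
  "heavy V d U S m = {E \<in> regular_edges V d. m \<le> card (edge_pairs E U S)}"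

text \<open>Double counting. A graph in \<open>heavy V d U S m\<close> has at least \<open>m\<close>
  choices of \<open>uv\<close>, each with at least \<open>?D\<close> partners. Conversely a switched
  graph still has \<open>m - 2\<close> pairs, so at most \<open>d * s - (m - 2)\<close> edges leave
  \<open>U\<close> for \<open>V - S\<close>, and likewise \<open>S\<close> for \<open>V - U\<close>;
  \<open>ux\<close> and \<open>vy\<close> are among these.\<close>

lemma switching_inequality:
  assumes fin: "finite V" and US: "U \<subseteq> V" "S \<subseteq> V" "card U = s" "card S = s" "U = S \<or> U \<inter> S = {}"
  shows "real (card (heavy V d U S m)) *
      (real m * (real (card V) * real d - 2 * (real d * real s) + real m - 2 * (real d * (real d + 1))))
    \<le> real (card (heavy V d U S (m - 2))) * real (d * s - (m - 2)) ^ 2"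
proof -
  let ?D = "real (card V) * real d - 2 * (real d * real s) + real m - 2 * (real d * (real d + 1))"
  have finUS: "finite U" "finite S" using US fin by (auto intro: finite_subset)
  have finG: "finite (heavy V d U S k)" for k
    using finite_regular_edges[OF fin] by (simp add: heavy_def)
  show ?thesis
  proof (cases "?D \<ge> 0")
    case False
    then show ?thesis by (intro order_trans[OF mult_nonneg_nonpos]) (auto intro: mult_nonneg_nonpos)
  next
    case True
    define Fw where "Fw = (SIGMA E:heavy V d U S m. SIGMA p:edge_pairs E U S. switch_partners V E U S p)"
    define Bw where "Bw = (SIGMA E:heavy V d U S (m - 2). edge_pairs E U (V - S) \<times> edge_pairs E S (V - U))"
    \<comment> \<open>The vertices are regrouped along the new edges, which is how a switching is
      counted from its result.\<close>
    define \<phi> where "\<phi> = (\<lambda>(E, (u :: 'a, v), (x, y)). (switch E u v x y, (u, x), (v, y)))"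
    have Fw: "\<exists>E u v x y. z = (E, (u, v), (x, y)) \<and> E \<in> regular_edges V d \<and> m \<le> card (edge_pairs E U S) \<and>
        u \<in> U \<and> v \<in> S \<and> {u, v} \<in> E \<and> x \<in> V - S \<and> y \<in> V - U \<and> {x, y} \<in> E \<and> u \<noteq> x \<and> v \<noteq> y \<and>
        {u, x} \<notin> E \<and> {v, y} \<notin> E" if "z \<in> Fw" for z
      using that fin unfolding Fw_def heavy_def
      by (auto simp: edge_pairs_def switch_partners_def)
    have "inj_on \<phi> Fw"
    proof (rule inj_onI)
      fix z z' assume z: "z \<in> Fw" "z' \<in> Fw" "\<phi> z = \<phi> z'"
      obtain E u v x y where 1: "z = (E, (u, v), (x, y))" "{u, v} \<in> E" "{x, y} \<in> E" "{u, x} \<notin> E" "{v, y} \<notin> E"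
        using Fw[OF z(1)] by blast
      obtain E' u' v' x' y' where 2: "z' = (E', (u', v'), (x', y'))" "{u', v'} \<in> E'" "{x', y'} \<in> E'"
        "{u', x'} \<notin> E'" "{v', y'} \<notin> E'"
        using Fw[OF z(2)] by blast
      have eq: "u = u'" "v = v'" "x = x'" "y = y'" "switch E u v x y = switch E' u' v' x' y'"
        using z(3) 1(1) 2(1) by (auto simp: \<phi>_def)
      then have "E = E'" using switch_undo[OF 1(2-5)] switch_undo[OF 2(2-5)] by metis
      then show "z = z'" using eq 1 2 by simp
    qed
    moreover have "\<phi> ` Fw \<subseteq> Bw"
    proof
      fix w assume "w \<in> \<phi> ` Fw"
      then obtain z where z: "z \<in> Fw" "w = \<phi> z" by blast
      obtain E u v x y where h: "z = (E, (u, v), (x, y))" "E \<in> regular_edges V d" "m \<le> card (edge_pairs E U S)"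
        "u \<in> U" "v \<in> S" "{u, v} \<in> E" "x \<in> V - S" "y \<in> V - U" "{x, y} \<in> E" "u \<noteq> x" "v \<noteq> y"
        "{u, x} \<notin> E" "{v, y} \<notin> E"
        using Fw[OF z(1)] by blast
      have "switch E u v x y \<in> regular_edges V d"
        using h by (intro switch_regular[OF fin]) auto
      moreover have "m - 2 \<le> card (edge_pairs (switch E u v x y) U S)"
        using switch_edge_pairs[OF US(5), of x y u v E] h finUS by simp
      moreover have "{u, x} \<in> switch E u v x y" "{v, y} \<in> switch E u v x y" by (auto simp: switch_def)
      ultimately show "w \<in> Bw" using h z(2) by (auto simp: \<phi>_def Bw_def heavy_def edge_pairs_def)
    qed
    moreover have "finite Bw"
      unfolding Bw_def using finG finUS fin by (intro finite_SigmaI finite_cartesian_product finite_edge_pairs) auto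
    ultimately have le: "card Fw \<le> card Bw" by (rule card_inj_on_le)
    have sp: "?D \<le> real (card (switch_partners V E U S p))"
      if "E \<in> heavy V d U S m" "p \<in> edge_pairs E U S" for E p
    proof -
      obtain u v where p: "p = (u, v)" by (cases p)
      have r: "E \<in> regular_edges V d" "m \<le> card (edge_pairs E U S)" using that by (auto simp: heavy_def)
      have "u \<in> V" "v \<in> V" using that p US by (auto simp: edge_pairs_def)
      from card_switch_partners[OF fin r(1) US(1,2) this]
      have "card V * d + m \<le> card (switch_partners V E U S p) + d * s + d * s + 2 * (d * (d + 1))"
        using r(2) unfolding p US(3,4) by linarith
      then have "real (card V * d + m) \<le> real (card (switch_partners V E U S p) + d * s + d * s + 2 * (d * (d + 1)))"
        by (rule of_nat_mono)
      then show ?thesis by (simp add: algebra_simps)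
    qed
    have finsp: "finite (switch_partners V E U S p)" if "E \<in> regular_edges V d" for E p
      using fin that by (cases p) (auto simp: switch_partners_def finite_edge_pairs
          intro: finite_subset[of _ "edge_pairs E (V - S) (V - U)"])
    have "card Fw = (\<Sum>E\<in>heavy V d U S m. \<Sum>p\<in>edge_pairs E U S. card (switch_partners V E U S p))"
      unfolding Fw_def using finG finUS finsp
      by (subst card_SigmaI) (auto simp: finite_edge_pairs heavy_def intro!: finite_SigmaI)
    then have "real (card Fw) = (\<Sum>E\<in>heavy V d U S m. \<Sum>p\<in>edge_pairs E U S. real (card (switch_partners V E U S p)))"
      by simp
    also have "\<dots> \<ge> (\<Sum>E\<in>heavy V d U S m. \<Sum>p\<in>edge_pairs E U S. ?D)"
      using sp by (intro sum_mono) auto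
    also have "(\<Sum>E\<in>heavy V d U S m. \<Sum>p\<in>edge_pairs E U S. ?D)
        = (\<Sum>E\<in>heavy V d U S m. real (card (edge_pairs E U S)) * ?D)" by simp
    also have "\<dots> \<ge> (\<Sum>E\<in>heavy V d U S m. real m * ?D)"
      using True by (intro sum_mono mult_right_mono) (auto simp: heavy_def)
    finally have lower: "real (card (heavy V d U S m)) * (real m * ?D) \<le> real (card Fw)" by simp
    have "card Bw = (\<Sum>E\<in>heavy V d U S (m - 2). card (edge_pairs E U (V - S)) * card (edge_pairs E S (V - U)))"
      unfolding Bw_def using finG finUS fin
      by (subst card_SigmaI) (auto simp: finite_edge_pairs card_cartesian_product)
    also have "\<dots> \<le> (\<Sum>E\<in>heavy V d U S (m - 2). (d * s - (m - 2)) * (d * s - (m - 2)))"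
    proof (intro sum_mono mult_le_mono)
      fix E assume E: "E \<in> heavy V d U S (m - 2)"
      then have r: "E \<in> regular_edges V d" "m - 2 \<le> card (edge_pairs E U S)" by (auto simp: heavy_def)
      show "card (edge_pairs E U (V - S)) \<le> d * s - (m - 2)"
        using card_edge_pairs_Diff(1)[OF fin r(1) US(1,2)] US r by simp
      show "card (edge_pairs E S (V - U)) \<le> d * s - (m - 2)"
        using card_edge_pairs_Diff(1)[OF fin r(1) US(2,1)] US r card_edge_pairs_swap[of E S U] by simp
    qed
    also have "\<dots> = card (heavy V d U S (m - 2)) * (d * s - (m - 2)) ^ 2" by (simp add: power2_eq_square)
    finally have "card Fw \<le> card (heavy V d U S (m - 2)) * (d * s - (m - 2)) ^ 2" using le by simp
    then have "real (card Fw) \<le> real (card (heavy V d U S (m - 2)) * (d * s - (m - 2)) ^ 2)"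
      by (rule of_nat_mono)
    then show ?thesis using lower by simp
  qed
qed

section \<open>Geometric decay of the tail\<close>

text \<open>Write \<open>w\<close> for the excess of \<open>p\<close> over
  \<open>d * s^2 / N\<close> and \<open>a\<close> for the largest possible excess. Then
  \<open>(a - w)^2 \<le> a^2 - a * w\<close>, and the gain
  \<open>N * a * w + d * s^2 * w = d * s * N * w\<close> pays for the error \<open>E\<close> because
  \<open>E * s \<le> N * w\<close>.\<close>

lemma switching_ratio_bound:
  fixes N d s p E :: real
  assumes "0 < N" "0 \<le> d" "0 \<le> s" "s \<le> N" "p \<le> d * s" "E \<ge> 0" "d * s ^ 2 / N + E * s / N \<le> p"
  shows "N * (d * s - p) ^ 2 \<le> d * s ^ 2 * (N * d - 2 * (d * s) + p + 2 - E)"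
proof -
  define w where "w = p - d * s ^ 2 / N"
  define a where "a = d * s * (1 - s / N)"
  have p: "d * s - p = a - w" using assms(1) by (simp add: a_def w_def field_simps power2_eq_square)
  have "E * s / N \<le> w" using assms(7) by (simp add: w_def)
  moreover have "0 \<le> E * s / N" using assms by simp
  ultimately have w: "0 \<le> w" "E * s \<le> N * w"
    using assms(1) by (linarith, simp add: pos_divide_le_eq mult.commute)
  have wa: "w \<le> a" using p assms(5) by simp
  have Na: "N * a ^ 2 = d * s ^ 2 * (N * d - 2 * (d * s) + d * s ^ 2 / N)"
    using assms(1) by (simp add: a_def field_simps power2_eq_square)
  have "(a - w) ^ 2 \<le> a ^ 2 - a * w"
    using mult_left_mono[OF wa w(1)] by (simp add: power2_eq_square algebra_simps)
  then have "N * (a - w) ^ 2 \<le> N * (a ^ 2 - a * w)" using assms(1) by (intro mult_left_mono) auto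
  also have "\<dots> = d * s ^ 2 * (N * d - 2 * (d * s) + d * s ^ 2 / N) - N * a * w"
    using Na by (simp add: algebra_simps)
  also have "\<dots> \<le> d * s ^ 2 * (N * d - 2 * (d * s) + d * s ^ 2 / N) + d * s ^ 2 * (w + 2 - E)"
  proof -
    have "N * a = d * s * (N - s)" using assms(1) by (simp add: a_def field_simps)
    then have "N * a * w = d * s * (N - s) * w" by simp
    moreover have "d * s * (E * s) \<le> d * s * (N * w)" using w assms by (intro mult_left_mono) auto
    ultimately have "d * s ^ 2 * E \<le> N * a * w + d * s ^ 2 * w"
      by (simp add: algebra_simps power2_eq_square)
    moreover have "0 \<le> d * s ^ 2 * 2" using assms by simp
    ultimately show ?thesis by (simp add: algebra_simps)
  qed
  also have "\<dots> = d * s ^ 2 * (N * d - 2 * (d * s) + p + 2 - E)"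
    unfolding w_def by (simp add: algebra_simps)
  finally show ?thesis unfolding p .
qed

text \<open>Above its mean, the tail decays at least as fast as a Poisson tail, but in steps of two.\<close>

lemma heavy_ratio:
  assumes fin: "finite V" and US: "U \<subseteq> V" "S \<subseteq> V" "card U = s" "card S = s" "U = S \<or> U \<inter> S = {}"
    and s: "1 \<le> s" and d: "1 \<le> d"
    and p: "real d * real s ^ 2 / real (card V) + 2 * (real d * (real d + 1)) * real s / real (card V) \<le> real p"
  shows "real (card (heavy V d U S (p + 2)))
    \<le> (real d * real s ^ 2 / real (card V)) / real (p + 2) * real (card (heavy V d U S p))"
proof (cases "p < d * s")
  case False
  have "heavy V d U S (p + 2) = {}"
    using card_edge_pairs_Diff(2)[OF fin _ US(1,2)] False US(3) by (fastforce simp: heavy_def)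
  then show ?thesis by simp
next
  case True
  let ?N = "real (card V)" and ?E = "2 * (real d * (real d + 1))"
  let ?D = "?N * real d - 2 * (real d * real s) + real (p + 2) - ?E"
  have sN: "s \<le> card V" using US card_mono[OF fin US(1)] by simp
  then have N: "?N > 0" using s by simp
  have le: "real p \<le> real d * real s" using True by (simp flip: of_nat_mult)
  have "?N * (real d * real s - real p) ^ 2 \<le> real d * real s ^ 2 * (?N * real d - 2 * (real d * real s) + real p + 2 - ?E)"
    using N sN p le by (intro switching_ratio_bound) auto
  then have r: "?N * (real d * real s - real p) ^ 2 \<le> real d * real s ^ 2 * ?D" by (simp add: algebra_simps)
  have lt: "real p < real d * real s" using True by (simp flip: of_nat_mult)
  then have "0 < ?N * (real d * real s - real p) ^ 2" using N by simp
  then have "0 < real d * real s ^ 2 * ?D" using r by linarith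
  \<comment> \<open>Strictness of \<open>p < d * s\<close> is what makes \<open>?D\<close> positive,
    so that it can be cancelled.\<close>
  then have D: "?D > 0" using s d by (elim zero_less_mult_pos) simp
  let ?T = "\<lambda>k. real (card (heavy V d U S k))"
  define D P where "D = ?D" and "P = real (p + 2)"
  have DP: "D > 0" "P > 0" using D by (simp_all add: D_def P_def)
  have "real (d * s - p) = real d * real s - real p" using True by (simp add: of_nat_diff)
  then have "?T (p + 2) * (P * D) \<le> ?T p * (real d * real s - real p) ^ 2"
    using switching_inequality[OF fin US, of d "p + 2"] by (simp add: D_def P_def)
  also have "\<dots> \<le> ?T p * (real d * real s ^ 2 * D / ?N)"
    using r N by (intro mult_left_mono) (simp_all add: pos_le_divide_eq D_def mult.commute)
  finally have "(?T (p + 2) * P) * D \<le> (?T p * (real d * real s ^ 2 / ?N)) * D"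
    by (simp add: mult.assoc)
  then have "?T (p + 2) * P \<le> ?T p * (real d * real s ^ 2 / ?N)"
    using DP(1) by (rule mult_right_le_imp_le)
  then have "?T (p + 2) \<le> ?T p * (real d * real s ^ 2 / ?N) / P"
    using DP(2) by (simp only: pos_le_divide_eq)
  then show ?thesis by (simp add: P_def mult.commute)
qed

section \<open>The union bound\<close>

text \<open>\<open>M\<close> exceeds \<open>\<mu> = d s^2 / card V\<close> by \<open>l s\<close>,
  and \<open>k\<close> steps of two use up at most half of this. So \<open>heavy_ratio\<close>
  applies at every step, with a factor of at most \<open>\<mu> / (\<mu> + l s / 2)\<close>, which is
  the base in the claim.\<close>

lemma heavy_tail:
  fixes l :: real
  assumes fin: "finite V" and US: "U \<subseteq> V" "S \<subseteq> V" "card U = s" "card S = s" "U = S \<or> U \<inter> S = {}"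
    and s: "1 \<le> s" and d: "1 \<le> d" and l: "l > 0"
    and l2: "2 * (real d * (real d + 1)) / real (card V) \<le> l / 2"
    and M: "real d * real s ^ 2 / real (card V) + l * real s < real M"
    and k: "2 * real k \<le> l * real s / 2"
  shows "real (card (heavy V d U S M))
    \<le> (1 / (1 + l / (2 * real d) * (real (card V) / real s))) ^ k * real (card (regular_edges V d))"
proof -
  let ?\<mu> = "real d * real s ^ 2 / real (card V)"
  let ?\<rho> = "1 / (1 + l / (2 * real d) * (real (card V) / real s))"
  let ?T = "\<lambda>m. real (card (heavy V d U S m))"
  have N: "real (card V) > 0" using s US card_mono[OF fin US(1)] by simp
  have \<mu>: "?\<mu> > 0" using N s d by simp
  have "?\<mu> + l * real s / 2 = ?\<mu> * (1 + l / (2 * real d) * (real (card V) / real s))"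
    using N s d by (simp add: field_simps power2_eq_square)
  moreover have "1 / X = m / (m * X)" if "m > 0" for m X :: real using that by simp
  ultimately have \<rho>: "?\<rho> = ?\<mu> / (?\<mu> + l * real s / 2)" using \<mu> by (simp only:)
  have low: "?\<mu> + l * real s / 2 < real (M - 2 * j)" and lowM: "2 * j < M" if "j \<le> k" for j
  proof -
    have "2 * real j \<le> l * real s / 2" using that k by linarith
    then have *: "?\<mu> + l * real s / 2 < real M - 2 * real j" using M by linarith
    moreover have "0 < l * real s / 2" using l s by simp
    ultimately have "real (2 * j) < real M" using \<mu> by simp
    then show "2 * j < M" by (simp only: of_nat_less_iff)
    then show "?\<mu> + l * real s / 2 < real (M - 2 * j)" using * by (simp add: of_nat_diff)
  qed
  have "?T M \<le> ?\<rho> ^ j * ?T (M - 2 * j)" if "j \<le> k" for j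
    using that
  proof (induction j)
    case 0
    then show ?case by simp
  next
    case (Suc j)
    define p where "p = M - 2 * Suc j"
    have p: "M - 2 * j = p + 2" using lowM[OF Suc.prems] by (simp add: p_def)
    have p\<mu>: "?\<mu> + l * real s / 2 \<le> real p" using low[OF Suc.prems] by (simp add: p_def)
    \<comment> \<open>The remaining half of the excess absorbs the error term of
      \<open>heavy_ratio\<close>.\<close>
    have "2 * (real d * (real d + 1)) / real (card V) * real s \<le> l / 2 * real s"
      using l2 by (rule mult_right_mono) simp
    then have "?T (p + 2) \<le> ?\<mu> / real (p + 2) * ?T p"
      using p\<mu> by (intro heavy_ratio[OF fin US s d]) simp
    also have "\<dots> \<le> ?\<rho> * ?T p"
      unfolding \<rho> using p\<mu> \<mu> l s by (intro mult_right_mono divide_left_mono mult_pos_pos add_pos_pos) auto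
    finally have "?T (p + 2) \<le> ?\<rho> * ?T p" .
    then have "?\<rho> ^ j * ?T (p + 2) \<le> ?\<rho> ^ j * (?\<rho> * ?T p)"
      using N l by (intro mult_left_mono) auto
    then show ?case using Suc p by (simp add: p_def mult_ac)
  qed
  from this[of k] have "?T M \<le> ?\<rho> ^ k * ?T (M - 2 * k)" by simp
  also have "\<dots> \<le> ?\<rho> ^ k * real (card (regular_edges V d))"
    using N l finite_regular_edges[OF fin] by (intro mult_left_mono of_nat_mono card_mono) (auto simp: heavy_def)
  finally show ?thesis .
qed

section \<open>Estimates and summation for the union bound\<close>

text \<open>Concavity of \<open>ln\<close> between \<open>1\<close> and \<open>1 + t\<close>:
  Bernoulli's inequality for exponents in the unit interval.\<close>

lemma ln_one_plus_mult_ge: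
  fixes a t :: real
  assumes "0 \<le> a" "a \<le> 1" "0 \<le> t"
  shows "a * ln (1 + t) \<le> ln (1 + a * t)"
proof -
  have "(1 - a) * ln 1 + a * ln (1 + t) \<le> ln ((1 - a) * 1 + a * (1 + t))"
    using concave_onD[OF ln_concave assms(1,2), of 1 "1 + t"] assms(3) by simp
  then show ?thesis by (simp add: algebra_simps)
qed

text \<open>With \<open>t = N / s\<close>, one term of \<open>(1 + 1 / t)^N \<le> exp 1 ^ s\<close>
  gives the bound \<open>(exp 1 * t)^s\<close>, and
  \<open>exp 1 * t \<le> 3 * t \<le> (1 + t)^2\<close>. The base \<open>1 + t\<close> is that of the
  tail bound.\<close>

lemma binomial_le_one_plus_ratio_power:
  assumes "1 \<le> s" "2 * s \<le> N"
  shows "real (N choose s) \<le> (1 + real N / real s) ^ (2 * s)"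
proof -
  define t where "t = real N / real s"
  have t: "t \<ge> 2" "t > 0" using assms by (auto simp: t_def field_simps)
  have "real (N choose s) * (1 / t) ^ s * 1 ^ (N - s) \<le> (\<Sum>k\<le>N. real (N choose k) * (1 / t) ^ k * 1 ^ (N - k))"
    using t assms by (intro member_le_sum) auto
  also have "\<dots> = (1 / t + 1) ^ N" by (simp add: binomial_ring)
  also have "\<dots> \<le> exp (1 / t) ^ N"
    using exp_ge_add_one_self[of "1 / t"] t by (intro power_mono) (auto simp: add.commute)
  also have "\<dots> = exp 1 ^ s"
    using assms by (simp add: t_def flip: exp_of_nat_mult)
  finally have "real (N choose s) \<le> exp 1 ^ s * t ^ s" using t by (simp add: field_simps)
  also have "\<dots> = (exp 1 * t) ^ s" by (simp add: power_mult_distrib)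
  also have "\<dots> \<le> ((1 + t) ^ 2) ^ s"
  proof (rule power_mono)
    have "exp 1 * t \<le> 3 * t" using exp_le t by (intro mult_right_mono) auto
    also have "\<dots> \<le> (1 + t) ^ 2" using zero_le_power2[of "t - 1"] t by (simp add: power2_eq_square algebra_simps)
    finally show "exp 1 * t \<le> (1 + t) ^ 2" .
  qed (use t in simp)
  finally show ?thesis by (simp add: t_def power_mult)
qed

text \<open>Since \<open>l * s \<ge> 8\<close>, rounding leaves \<open>k \<ge> l * s / 8\<close>.
  The exponent of \<open>1 + t\<close> is then at least
  \<open>l * s / 8 * (l / (2 * d)) = s * ln d / 4\<close>, and \<open>ln d \<ge> 24\<close> makes
  this \<open>6 * s\<close>.\<close>

lemma tail_rate:
  fixes d l t :: real
  assumes "1 \<le> d" "24 \<le> ln d" "l = 2 * sqrt (d * ln d)" "1 \<le> s" "0 < t"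
    and k: "k = nat \<lfloor>l * real s / 4\<rfloor>"
  shows "(1 / (1 + l / (2 * d) * t)) ^ k \<le> 1 / (1 + t) ^ (6 * s)"
proof -
  have d: "d > 0" using assms(1) by simp
  have l2: "l ^ 2 = 4 * (d * ln d)" using assms d by (simp add: power_mult_distrib)
  have "d * ln d \<ge> 1 * 24" using assms by (intro mult_mono) auto
  then have "sqrt 16 \<le> sqrt (d * ln d)" by (intro real_sqrt_le_mono) simp
  then have l8: "l \<ge> 8" using assms(3) by simp
  let ?a = "l / (2 * d)"
  have "l ^ 2 \<le> (2 * d) ^ 2"
    unfolding l2 using ln_le_minus_one[OF d] d by (simp add: power2_eq_square)
  then have "l \<le> 2 * d" by (rule power2_le_imp_le) (use d in simp)
  then have a: "0 \<le> ?a" "?a \<le> 1" using d l8 by auto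
  have "8 \<le> l * real s" using mult_mono[of 8 l 1 "real s"] l8 assms(4) by simp
  then have "l * real s / 8 \<le> l * real s / 4 - 1" by simp
  also have "\<dots> \<le> real k" unfolding k by linarith
  finally have "l * real s / 8 * (?a * ln (1 + t)) \<le> real k * ln (1 + ?a * t)"
    using ln_one_plus_mult_ge[OF a, of t] assms l8 a by (intro mult_mono) auto
  then have "l * real s / 8 * ?a * ln (1 + t) \<le> real k * ln (1 + ?a * t)" by (simp only: mult.assoc)
  moreover have "l * real s / 8 * ?a = l ^ 2 / (16 * d) * real s" by (simp add: power2_eq_square)
  moreover have "l ^ 2 / (16 * d) = ln d / 4" unfolding l2 using d by simp
  ultimately have "ln d / 4 * real s * ln (1 + t) \<le> real k * ln (1 + ?a * t)" by (simp only:)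
  moreover have "6 * real s * ln (1 + t) \<le> ln d / 4 * real s * ln (1 + t)"
    using assms by (intro mult_right_mono) auto
  ultimately have "real (6 * s) * ln (1 + t) \<le> real k * ln (1 + ?a * t)" by simp
  moreover have pos: "1 + t > 0" "1 + ?a * t > 0" using assms a by (auto intro: add_pos_nonneg)
  ultimately have "ln ((1 + t) ^ (6 * s)) \<le> ln ((1 + ?a * t) ^ k)" by (simp add: ln_realpow)
  then have "(1 + t) ^ (6 * s) \<le> (1 + ?a * t) ^ k"
    using pos by (subst (asm) ln_le_cancel_iff) auto
  then show ?thesis using pos by (simp add: power_one_over divide_simps)
qed

text \<open>With \<open>t = 2 n / s\<close>, there are at most \<open>(1 + t)^(4 s)\<close> pairs of
  sets and each fails in a fraction of at most \<open>(1 + t)^(-6 s)\<close> of the graphs. The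
  remaining \<open>(1 + t)^(-2 s)\<close> is at most \<open>1 / n^2\<close>, and there are
  \<open>n\<close> values of \<open>s\<close>.\<close>

lemma card_not_pseudorandom:
  fixes V :: "'a set"
  assumes fin: "finite V" and cV: "card V = 2 * n" "1 \<le> n" and d: "1 \<le> d" "24 \<le> ln (real d)"
    and l: "l = 2 * sqrt (real d * ln (real d))"
    and l2: "2 * (real d * (real d + 1)) / real (card V) \<le> l / 2"
  shows "real (card {E \<in> regular_edges V d. \<not> pseudorandom V d l E}) * real n \<le> real (card (regular_edges V d))"
proof -
  let ?G = "regular_edges V d"
  have "0 < real d * ln (real d)" using d by (intro mult_pos_pos) linarith+
  then have l0: "l > 0" using l by simp
  \<comment> \<open>The least integer strictly above the bound, so that violating it means lying in
    \<open>heavy\<close> at level \<open>M s\<close>.\<close>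
  define M where "M s = nat \<lfloor>real d * real s ^ 2 / real (card V) + l * real s\<rfloor> + 1" for s
  have M: "real d * real s ^ 2 / real (card V) + l * real s < real (M s)" for s
    unfolding M_def using l0 by linarith
  have M': "M s \<le> j" if "real d * real s ^ 2 / real (card V) + l * real s < real j" for s j
    using that l0 unfolding M_def
    by (smt (verit, best) Suc_eq_plus1 Suc_leI divide_nonneg_nonneg floor_less_iff mult_nonneg_nonneg nat_less_iff
        of_int_of_nat_eq of_nat_0_le_iff zero_le_floor zero_le_power2)
  define P where "P s = {(U, S). U \<subseteq> V \<and> S \<subseteq> V \<and> card U = s \<and> card S = s \<and> (U = S \<or> U \<inter> S = {})}" for s
  have finP: "finite (P s)" for s
    by (rule finite_subset[of _ "Pow V \<times> Pow V"]) (use fin in \<open>auto simp: P_def\<close>)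
  have finH: "finite (heavy V d U S m)" for U S m
    using finite_regular_edges[OF fin] by (simp add: heavy_def)
  have cP: "real (card (P s)) \<le> (1 + real (2 * n) / real s) ^ (4 * s)" if "s \<in> {1..n}" for s
  proof -
    let ?K = "{A. A \<subseteq> V \<and> card A = s}"
    have "card (P s) \<le> card (?K \<times> ?K)"
      using fin by (intro card_mono finite_cartesian_product) (auto simp: P_def)
    also have "\<dots> = (2 * n choose s) * (2 * n choose s)"
      using n_subsets[OF fin] cV by (simp add: card_cartesian_product)
    finally have "real (card (P s)) \<le> real (2 * n choose s) * real (2 * n choose s)"
      by (simp flip: of_nat_mult)
    also have "\<dots> \<le> (1 + real (2 * n) / real s) ^ (2 * s) * (1 + real (2 * n) / real s) ^ (2 * s)"
      using binomial_le_one_plus_ratio_power[of s "2 * n"] that by (intro mult_mono) auto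
    also have "\<dots> = (1 + real (2 * n) / real s) ^ (4 * s)" by (simp flip: power_add)
    finally show ?thesis .
  qed
  have sub: "{E \<in> ?G. \<not> pseudorandom V d l E} \<subseteq> (\<Union>s\<in>{1..n}. \<Union>(U, S)\<in>P s. heavy V d U S (M s))"
  proof
    fix E assume E: "E \<in> {E \<in> ?G. \<not> pseudorandom V d l E}"
    then obtain U S where US: "U \<subseteq> V" "S \<subseteq> V" "card U = card S" "U = S \<or> U \<inter> S = {}"
      "1 \<le> card S" "2 * card S \<le> card V"
      "real d * real (card S) ^ 2 / real (card V) + l * real (card S) < real (card (edge_pairs E U S))"
      unfolding pseudorandom_def by (auto simp: not_le)
    then have "E \<in> heavy V d U S (M (card S))" using E M' by (simp add: heavy_def)
    moreover have "(U, S) \<in> P (card S)" "card S \<in> {1..n}" using US cV by (auto simp: P_def)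
    ultimately show "E \<in> (\<Union>s\<in>{1..n}. \<Union>(U, S)\<in>P s. heavy V d U S (M s))" by blast
  qed
  have one: "real (card (heavy V d U S (M s))) \<le> 1 / (1 + real (2 * n) / real s) ^ (6 * s) * real (card ?G)"
    if "s \<in> {1..n}" "(U, S) \<in> P s" for s U S
  proof -
    let ?k = "nat \<lfloor>l * real s / 4\<rfloor>"
    have "0 \<le> l * real s / 4" using l0 by simp
    then have k: "2 * real ?k \<le> l * real s / 2" by linarith
    have "real (card (heavy V d U S (M s)))
        \<le> (1 / (1 + l / (2 * real d) * (real (card V) / real s))) ^ ?k * real (card ?G)"
      using that M k d(1) l0 l2 by (intro heavy_tail[OF fin]) (auto simp: P_def)
    also have "\<dots> \<le> 1 / (1 + real (card V) / real s) ^ (6 * s) * real (card ?G)"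
      using that d cV l by (intro mult_right_mono tail_rate) auto
    finally show ?thesis using cV by simp
  qed
  have "card {E \<in> ?G. \<not> pseudorandom V d l E} \<le> card (\<Union>s\<in>{1..n}. \<Union>(U, S)\<in>P s. heavy V d U S (M s))"
    using finP finH by (intro card_mono[OF _ sub]) auto
  also have "\<dots> \<le> (\<Sum>s\<in>{1..n}. card (\<Union>(U, S)\<in>P s. heavy V d U S (M s)))"
    by (rule card_UN_le) simp
  also have "\<dots> \<le> (\<Sum>s\<in>{1..n}. \<Sum>(U, S)\<in>P s. card (heavy V d U S (M s)))"
    using finP by (intro sum_mono card_UN_le[THEN order_trans]) (auto simp: case_prod_beta)
  finally have "real (card {E \<in> ?G. \<not> pseudorandom V d l E})
      \<le> (\<Sum>s\<in>{1..n}. \<Sum>(U, S)\<in>P s. real (card (heavy V d U S (M s))))"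
    unfolding case_prod_beta by (simp flip: of_nat_sum)
  also have "\<dots> \<le> (\<Sum>s\<in>{1..n}. \<Sum>(U, S)\<in>P s. 1 / (1 + real (2 * n) / real s) ^ (6 * s) * real (card ?G))"
    using one by (intro sum_mono) auto
  also have "\<dots> = (\<Sum>s\<in>{1..n}. real (card (P s)) * (1 / (1 + real (2 * n) / real s) ^ (6 * s)) * real (card ?G))"
    by (simp add: case_prod_beta)
  also have "\<dots> \<le> (\<Sum>s\<in>{1..n}. 1 / real n ^ 2 * real (card ?G))"
  proof (intro sum_mono mult_right_mono)
    fix s assume s: "s \<in> {1..n}"
    define t where "t = real (2 * n) / real s"
    have t: "t > 0" using s by (simp add: t_def)
    \<comment> \<open>\<open>s * t = 2 * n\<close> for every \<open>s\<close>, so Bernoulli's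
      inequality bounds \<open>(1 + t)^s\<close> from below uniformly in \<open>s\<close>.\<close>
    have "real n \<le> 1 + real s * t" using s by (simp add: t_def)
    also have "\<dots> \<le> (1 + t) ^ s" using t by (intro Bernoulli_inequality) simp
    finally have "real n ^ 2 \<le> ((1 + t) ^ s) ^ 2" by (intro power_mono) auto
    then have n2: "real n ^ 2 \<le> (1 + t) ^ (2 * s)" by (simp add: mult.commute flip: power_mult)
    have "real (card (P s)) * (1 / (1 + t) ^ (6 * s)) \<le> (1 + t) ^ (4 * s) * (1 / (1 + t) ^ (6 * s))"
      using cP[OF s] t by (intro mult_right_mono) (auto simp: t_def)
    also have "\<dots> = 1 / (1 + t) ^ (2 * s)"
      using t by (simp add: divide_simps flip: power_add)
    also have "\<dots> \<le> 1 / real n ^ 2" using n2 cV(2) t by (intro divide_left_mono) (auto intro!: mult_pos_pos)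
    finally show "real (card (P s)) * (1 / (1 + real (2 * n) / real s) ^ (6 * s)) \<le> 1 / real n ^ 2"
      by (simp add: t_def)
  qed simp
  also have "\<dots> = real (card ?G) / real n" by (simp add: power2_eq_square)
  finally show ?thesis using cV(2) by (simp add: pos_le_divide_eq)
qed

section \<open>Existence of regular graphs\<close>

text \<open>Translation by \<open>c\<close> permutes the residues modulo \<open>n\<close>.\<close>

lemma card_shifted_residues:
  assumes "d \<le> n"
  shows "card {x \<in> {..<n}. (c + x) mod n < d} = (d :: nat)"
proof (cases "n = 0")
  case True
  then show ?thesis using assms by simp
next
  case False
  let ?f = "\<lambda>x. (c + x) mod n"
  have inj: "inj_on ?f {..<n}"
  proof (rule inj_onI)
    fix x y assume "x \<in> {..<n}" "y \<in> {..<n}" "?f x = ?f y"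
    then show "x = y"
    proof (induction x y rule: linorder_wlog)
      case (le x y)
      then have "n dvd (c + y) - (c + x)" by (subst mod_eq_dvd_iff_nat[symmetric]) auto
      then show ?case using le by (auto dest: dvd_imp_le)
    qed simp
  qed
  have "?f ` {..<n} = {..<n}"
    by (rule endo_inj_surj) (use inj False in auto)
  then have "?f ` {x \<in> {..<n}. ?f x < d} = {..<d}" using assms by (auto simp: image_iff)
  moreover have "card (?f ` {x \<in> {..<n}. ?f x < d}) = card {x \<in> {..<n}. ?f x < d}"
    by (rule card_image, rule inj_on_subset[OF inj]) auto
  ultimately show ?thesis by simp
qed

text \<open>A bipartite circulant graph: vertex \<open>i\<close> of the first half meets vertex
  \<open>r\<close> of the second when \<open>i + r\<close> falls into \<open>d\<close> fixed
  residues. The sum treats both halves alike. Nonemptiness makes \<open>pmf_of_set\<close> the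
  uniform distribution.\<close>

lemma regular_edges_nonempty:
  assumes "d \<le> n"
  shows "regular_edges {1..2 * n} d \<noteq> {}"
proof -
  define E where "E = {{Suc i, n + Suc r} | i r. i < n \<and> r < n \<and> (i + r) mod n < d}"
  have "edges_on {1..2 * n} E" by (auto simp: edges_on_def E_def card_insert_if)
  moreover have "nbrs E {1..2 * n} v = d" if v: "v \<in> {1..2 * n}" for v
  proof (cases "v \<le> n")
    case True
    define i where "i = v - 1"
    have i: "v = Suc i" "i < n" using v True by (auto simp: i_def)
    have "{b \<in> {1..2 * n}. {v, b} \<in> E} = (\<lambda>r. n + Suc r) ` {r \<in> {..<n}. (i + r) mod n < d}"
      using i by (auto simp: E_def doubleton_eq_iff)
    then show ?thesis using card_shifted_residues[OF assms, of i] by (simp add: card_image inj_on_def)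
  next
    case False
    define r where "r = v - n - 1"
    have r: "v = n + Suc r" "r < n" using v False by (auto simp: r_def)
    have "{b \<in> {1..2 * n}. {v, b} \<in> E} = Suc ` {i \<in> {..<n}. (r + i) mod n < d}"
      using r by (auto simp: E_def doubleton_eq_iff add.commute)
    then show ?thesis using card_shifted_residues[OF assms, of r] by (simp add: card_image)
  qed
  ultimately show ?thesis by (auto simp: regular_edges_def)
qed

lemma regular_graphs_eq: "regular_graphs m d = Pair {1..m} ` regular_edges {1..m} d"
proof -
  have "({1..m}, E) \<in> regular_graphs m d \<longleftrightarrow> E \<in> regular_edges {1..m} d" for E
    using card_incident_edges[of "{1..m}" E]
    unfolding regular_graphs_def regular_edges_def simple_graph_def vertex_degree_def mem_Collect_eq
      fst_conv snd_conv edges_on_def[symmetric] by auto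
  moreover have "G = ({1..m}, snd G)" if "G \<in> regular_graphs m d" for G
    using that by (cases G) (simp add: regular_graphs_def)
  ultimately show ?thesis by (auto simp: image_iff del: atLeastAtMost_iff)
qed

section \<open>Resilience of random regular graphs\<close>

text \<open>With \<open>l = 2 sqrt(d ln d)\<close> the resilience lies between
  \<open>d/2 - 2 l\<close> and \<open>d/2 + l + 1\<close>. The strict lower inequality follows
  because \<open>4 sqrt d\<close> is positive.\<close>

lemma pseudorandom_resilience:
  fixes n d :: nat
  assumes n: "1 \<le> n" and d: "1 \<le> d" "24 \<le> ln (real d)"
    and E: "E \<in> regular_edges {1..2 * n} d"
    and pr: "pseudorandom {1..2 * n} d (2 * sqrt (real d * ln (real d))) E"
  shows "real d / 2 - 10 * sqrt (real d * ln (real d)) - 4 * sqrt (real d)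
      < real (local_resilience ({1..2 * n}, E) has_perfect_matching)"
    "real (local_resilience ({1..2 * n}, E) has_perfect_matching)
      \<le> real d / 2 + 2 * sqrt (real d * ln (real d)) + 2"
proof -
  let ?V = "{1..2 * n}"
  have E': "edges_on ?V E" "\<And>v. v \<in> ?V \<Longrightarrow> nbrs E ?V v = d" using E by (auto simp: regular_edges_def)
  have l: "0 \<le> 2 * sqrt (real d * ln (real d))" using d by simp
  have "real (local_resilience (?V, E) has_perfect_matching) \<le> real d / 2 + 2 * sqrt (real d * ln (real d)) + 1"
    by (rule resilience_upper[OF _ _ n E' pr l]) auto
  then show "real (local_resilience (?V, E) has_perfect_matching)
      \<le> real d / 2 + 2 * sqrt (real d * ln (real d)) + 2" by simp
  obtain H where H: "spanning_subgraph H (?V, E)"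
    "max_degree H = local_resilience (?V, E) has_perfect_matching"
    "\<not> has_perfect_matching (delete_edges (?V, E) H)"
    using local_resilience_perfect_matching_attained[of "(?V, E)"] n by auto
  have "real d / 2 - 2 * (2 * sqrt (real d * ln (real d))) \<le> real (max_degree H)"
    by (rule resilience_lower[OF _ _ n E' pr l H(1,3)]) auto
  moreover have "0 < sqrt (real d)" "0 \<le> sqrt (real d * ln (real d))" using d by auto
  ultimately show "real d / 2 - 10 * sqrt (real d * ln (real d)) - 4 * sqrt (real d)
      < real (local_resilience (?V, E) has_perfect_matching)" unfolding H(2) by linarith
qed

theorem theorem3:
  "\<exists>d0::nat. d0 > 0 \<and> (\<forall>d\<ge>d0.
     (\<lambda>n. measure_pmf.prob (random_regular_graph (2 * n) d)
        {G. real d / 2 - 10 * sqrt (real d * ln (real d)) - 4 * sqrt (real d)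
              < real (local_resilience G has_perfect_matching) \<and>
            real (local_resilience G has_perfect_matching)
              \<le> real d / 2 + 2 * sqrt (real d * ln (real d)) + 2})
     \<longlonglongrightarrow> 1)"
proof -
  \<comment> \<open>The threshold \<open>d0\<close> comes from the constant \<open>24\<close>
    required by \<open>tail_rate\<close>.\<close>
  have "\<forall>\<^sub>F d :: nat in sequentially. 24 \<le> ln (real d)" by real_asymp
  then obtain d1 :: nat where d1: "\<And>d. d \<ge> d1 \<Longrightarrow> 24 \<le> ln (real d)"
    by (auto simp: eventually_sequentially)
  show ?thesis
  proof (intro exI[of _ "max 1 d1"] conjI allI impI)
    fix d assume "d \<ge> max 1 d1"
    then have d: "1 \<le> d" "24 \<le> ln (real d)" using d1 by auto
    define l where "l = 2 * sqrt (real d * ln (real d))"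
    let ?good = "{G. real d / 2 - 10 * sqrt (real d * ln (real d)) - 4 * sqrt (real d)
              < real (local_resilience G has_perfect_matching) \<and>
            real (local_resilience G has_perfect_matching)
              \<le> real d / 2 + 2 * sqrt (real d * ln (real d)) + 2}"
    let ?p = "\<lambda>n. measure_pmf.prob (random_regular_graph (2 * n) d) ?good"
    have "0 < real d * ln (real d)" using d by (intro mult_pos_pos) linarith+
    then have "l > 0" by (simp add: l_def)
    then have "\<forall>\<^sub>F n :: nat in sequentially. 2 * (real d * (real d + 1)) / real (2 * n) \<le> l / 2"
      by real_asymp
    \<comment> \<open>\<open>d \<le> n\<close> ensures that a \<open>d\<close>-regular graph
      exists.\<close>
    moreover have "\<forall>\<^sub>F n :: nat in sequentially. d \<le> n \<and> 1 \<le> n"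
      using eventually_ge_at_top[of "max 1 d"] by eventually_elim simp
    ultimately have low: "\<forall>\<^sub>F n in sequentially. 1 - 1 / real n \<le> ?p n"
    proof eventually_elim
      case (elim n)
      let ?V = "{1..2 * n}" and ?G = "regular_edges {1..2 * n} d"
      let ?B = "{E \<in> ?G. \<not> pseudorandom ?V d l E}"
      have finG: "finite ?G" by (rule finite_regular_edges) simp
      have neG: "?G \<noteq> {}" using regular_edges_nonempty[of d n] elim by simp
      then have cG: "card ?G > 0" using finG by (simp add: card_gt_0_iff)
      have B: "real (card ?B) * real n \<le> real (card ?G)"
        using elim d by (intro card_not_pseudorandom) (auto simp: l_def)
      have sub: "Pair ?V ` (?G - ?B) \<subseteq> regular_graphs (2 * n) d \<inter> ?good"
        using pseudorandom_resilience[of n d] elim d by (auto simp: regular_graphs_eq l_def)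
      have "card ?G - card ?B = card (?G - ?B)"
        using finG by (subst card_Diff_subset) auto
      also have "\<dots> = card (Pair ?V ` (?G - ?B))" by (simp add: card_image inj_on_def)
      also have "\<dots> \<le> card (regular_graphs (2 * n) d \<inter> ?good)"
        using sub finite_regular_graphs by (intro card_mono) auto
      finally have "real (card ?G) - real (card ?B) \<le> real (card (regular_graphs (2 * n) d \<inter> ?good))"
        by linarith
      moreover have "real (card ?B) \<le> real (card ?G) / real n"
        using B elim by (simp add: pos_le_divide_eq)
      ultimately have "real (card ?G) * (1 - 1 / real n) \<le> real (card (regular_graphs (2 * n) d \<inter> ?good))"
        by (simp add: algebra_simps)
      moreover have "?p n = real (card (regular_graphs (2 * n) d \<inter> ?good)) / real (card (regular_graphs (2 * n) d))"
        unfolding random_regular_graph_def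
        by (rule measure_pmf_of_set) (use neG finG in \<open>auto simp: regular_graphs_eq\<close>)
      moreover have "card (regular_graphs (2 * n) d) = card ?G"
        by (simp add: regular_graphs_eq card_image inj_on_def)
      ultimately show ?case using cG by (simp add: pos_le_divide_eq mult.commute)
    qed
    show "?p \<longlonglongrightarrow> 1"
    proof (rule tendsto_sandwich[OF low])
      show "\<forall>\<^sub>F n in sequentially. ?p n \<le> 1" by simp
      show "(\<lambda>n. 1 - 1 / real n) \<longlonglongrightarrow> 1" by real_asymp
    qed simp
  qed simp
qed

end
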